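(* Let $T$ be Plotkin's tie and let $\mathsf{Disk}^{\top}$ be the planar closed-disk domain with a greatest element adjoined. The Scott function space $[\mathsf{Disk}^{\top}\to T]$ is a continuous dcpo but is not an FS-domain.
   Context: A dcpo is a poset in which every directed (in particular nonempty) subset has a supremum. A map between dcpos is Scott-continuous if it is monotone and preserves suprema of directed subsets. For dcpos $D,E$, the Scott function space $[D\to E]$ is the dcpo of all Scott-continuous maps $D\to E$ with the pointwise order; directed suprema are computed pointwise. In a dcpo $D$, $a\ll x$ ($a$ is way below $x$) if for every directed $A\subseteq D$ with $x\le\bigvee A$ there is $y\in A$ with $a\le y$. A dcpo $D$ is continuous if for every $x\in D$ the set $\{a\in D: a\ll x\}$ is directed and has supremum $x$. A Scott-continuous map $f:D\to D$ is finitely separated from the identity if there is a finite set $M\subseteq D$ such that for every $x\in D$ there is $m\in M$ with $f(x)\le m\le x$. An FS-domain is a continuous dcpo $D$ for which there is a directed family (pointwise order) $(f_i)_{i\in I}$ of Scott-continuous maps $D\to D$, each finitely separated from the identity, with $x=\bigvee_{i\in I}f_i(x)$ for every $x\in D$. Plotkin's tie is the poset $T=\{\bot,\top\}\cup\{a_n,b_n:n\ge 1\}$ (all listed elements distinct) with $\bot\le x\le\top$ for all $x\in T$ and, for $u,v\in\{a,b\}$, $u_m\le v_n$ if and only if $m<n$ or ($m=n$ and $u_m=v_n$). The planar closed-disk domain $\mathsf{Disk}$ consists of all closed Euclidean disks $B(z,r)=\{w\in\mathbb{R}^2:\lVert w-z\rVert\le r\}$ with $z\in\mathbb{R}^2$,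 $r\ge 0$, together with the whole plane $\mathbb{R}^2$, ordered by reverse inclusion. $\mathsf{Disk}^{\top}=\mathsf{Disk}\cup\{\top\}$ is obtained by adjoining a new element $\top\notin\mathsf{Disk}$ with $x\le\top$ for all $x\in\mathsf{Disk}$. *)

theory Defs
  imports
    "HOL-Analysis.Analysis"
    "HOL-Algebra.Order"
    "HOL-Library.FuncSet"
    "HOL-Library.Lattice_Constructions"
begin

section \<open>Domains\<close>

text \<open>
  Posets are records \<^typ>\<open>'a gorder\<close> whose equivalence is equality; only the behaviour on the
  carrier matters.
\<close>

definition is_sup :: "('a, 'b) gorder_scheme \<Rightarrow> 'a \<Rightarrow> 'a set \<Rightarrow> bool"
  where "is_sup D s A \<longleftrightarrow> least D s (Upper D A)"

definition directed :: "('a, 'b) gorder_scheme \<Rightarrow> 'a set \<Rightarrow> bool"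
  where "directed D A \<longleftrightarrow>
    A \<subseteq> carrier D \<and> A \<noteq> {} \<and> (\<forall>x\<in>A. \<forall>y\<in>A. \<exists>z\<in>A. x \<sqsubseteq>\<^bsub>D\<^esub> z \<and> y \<sqsubseteq>\<^bsub>D\<^esub> z)"

definition dcpo :: "('a, 'b) gorder_scheme \<Rightarrow> bool"
  where "dcpo D \<longleftrightarrow> partial_order D \<and> (\<forall>A. directed D A \<longrightarrow> (\<exists>s. is_sup D s A))"

definition way_below :: "('a, 'b) gorder_scheme \<Rightarrow> 'a \<Rightarrow> 'a \<Rightarrow> bool"
  where "way_below D a x \<longleftrightarrow> a \<in> carrier D \<and> x \<in> carrier D \<and>
    (\<forall>A s. directed D A \<and> is_sup D s A \<and> x \<sqsubseteq>\<^bsub>D\<^esub> s \<longrightarrow> (\<exists>y\<in>A. a \<sqsubseteq>\<^bsub>D\<^esub> y))"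

definition continuous_dcpo :: "('a, 'b) gorder_scheme \<Rightarrow> bool"
  where "continuous_dcpo D \<longleftrightarrow> dcpo D \<and>
    (\<forall>x\<in>carrier D. directed D {a \<in> carrier D. way_below D a x} \<and>
      is_sup D x {a \<in> carrier D. way_below D a x})"

definition scott_continuous ::
    "('a, 'c) gorder_scheme \<Rightarrow> ('b, 'd) gorder_scheme \<Rightarrow> ('a \<Rightarrow> 'b) \<Rightarrow> bool"
  where "scott_continuous D E f \<longleftrightarrow>
    f \<in> carrier D \<rightarrow> carrier E \<and> isotone D E f \<and>
    (\<forall>A s. directed D A \<and> is_sup D s A \<longrightarrow> is_sup E (f s) (f ` A))"

text \<open>
  Maps are taken to be extensional (\<^const>\<open>undefined\<close> off the carrier of the domain), so that
  elements of the function space correspond bijectively to maps between the carriers.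
\<close>

definition scott_space ::
    "('a, 'c) gorder_scheme \<Rightarrow> ('b, 'd) gorder_scheme \<Rightarrow> ('a \<Rightarrow> 'b) gorder"
  where "scott_space D E =
    \<lparr> carrier = {f \<in> carrier D \<rightarrow>\<^sub>E carrier E. scott_continuous D E f},
      eq = (=),
      le = (\<lambda>f g. \<forall>x\<in>carrier D. f x \<sqsubseteq>\<^bsub>E\<^esub> g x) \<rparr>"

definition finitely_separated :: "('a, 'b) gorder_scheme \<Rightarrow> ('a \<Rightarrow> 'a) \<Rightarrow> bool"
  where "finitely_separated D f \<longleftrightarrow>
    (\<exists>M. finite M \<and> M \<subseteq> carrier D \<and>
      (\<forall>x\<in>carrier D. \<exists>m\<in>M. f x \<sqsubseteq>\<^bsub>D\<^esub> m \<and> m \<sqsubseteq>\<^bsub>D\<^esub> x))"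

text \<open>A directed family of maps is represented by the directed set of its members.\<close>

definition FS_domain :: "('a, 'b) gorder_scheme \<Rightarrow> bool"
  where "FS_domain D \<longleftrightarrow> continuous_dcpo D \<and>
    (\<exists>F. directed (scott_space D D) F \<and> (\<forall>f\<in>F. finitely_separated D f) \<and>
      (\<forall>x\<in>carrier D. is_sup D x ((\<lambda>f. f x) ` F)))"

section \<open>Plotkin's tie\<close>

datatype tie_letter = La | Lb

datatype tie = Tie_bot | Tie_top | Tie_elt tie_letter nat

fun tie_le :: "tie \<Rightarrow> tie \<Rightarrow> bool"
  where
    "tie_le Tie_bot y \<longleftrightarrow> True"
  | "tie_le Tie_top y \<longleftrightarrow> y = Tie_top"
  | "tie_le (Tie_elt u m) Tie_bot \<longleftrightarrow> False"
  | "tie_le (Tie_elt u m) Tie_top \<longleftrightarrow> True"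
  | "tie_le (Tie_elt u m) (Tie_elt v n) \<longleftrightarrow> m < n \<or> (m = n \<and> Tie_elt u m = Tie_elt v n)"

definition plotkin_tie :: "tie gorder"
  where "plotkin_tie =
    \<lparr> carrier = {Tie_bot, Tie_top} \<union> {Tie_elt u n | u n. n \<ge> 1}, eq = (=), le = tie_le \<rparr>"

section \<open>The closed-disk domain\<close>

definition Disk :: "(real ^ 2) set gorder"
  where "Disk =
    \<lparr> carrier = {cball z r | z r. r \<ge> 0} \<union> {UNIV}, eq = (=), le = (\<lambda>X Y. Y \<subseteq> X) \<rparr>"

text \<open>
  Only the datatype \<^typ>\<open>'a top\<close> is used, not its class instances: the order on
  \<^term>\<open>top.Value x\<close> comes from the record.
\<close>

definition adjoin_top :: "('a, 'b) gorder_scheme \<Rightarrow> 'a top gorder"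
  where "adjoin_top D =
    \<lparr> carrier = top.Value ` carrier D \<union> {top.Top},
      eq = (=),
      le = (\<lambda>x y. case y of
        top.Top \<Rightarrow> True
      | top.Value v \<Rightarrow> (case x of top.Top \<Rightarrow> False | top.Value u \<Rightarrow> u \<sqsubseteq>\<^bsub>D\<^esub> v)) \<rparr>"

end

theory Submission
  imports Defs
begin

text \<open>
  The positive half holds for every poset \<open>D\<close> that carries an FS family, i.e. a directed set \<open>F\<close> of
  finitely separated Scott-continuous self-maps with pointwise supremum the identity.
  For \<open>f : D \<rightarrow> T\<close> and \<open>d \<in> F\<close> separated from the identity by a finite set \<open>M\<close>, the map \<open>f \<circ> d\<close> lies
  below \<open>f\<close> and factors, as far as the order is concerned, through the finitely many values
  \<open>f m\<close> with \<open>m \<in> M\<close>. If all these values were different from \<open>\<top>\<close>, they would be compact in the tie and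
  \<open>f \<circ> d\<close> would be way below \<open>f\<close>. In general choose \<open>N\<close> above the levels of all values \<open>f m \<noteq> \<top>\<close> and
  replace every element of the tie of level at least \<open>N\<close> by \<open>a\<^sub>N\<close>. This truncation is not
  below the identity, since it sends \<open>b\<^sub>N\<close> to \<open>a\<^sub>N\<close>; but \<open>f (d x)\<close> has level at least \<open>N\<close>
  only if \<open>d x \<le> m \<le> x\<close> for some \<open>m \<in> M\<close> with \<open>f m = \<top>\<close>, and then \<open>f x = \<top>\<close>. So the truncated map
  is still below \<open>f\<close>, and it is way below \<open>f\<close> because it is controlled by finitely many compact
  values (\<open>approximant_way_below\<close>). These approximants form a directed set with supremum \<open>f\<close>
  (\<open>approximants_directed\<close>, \<open>approximants_sup\<close>).

  An FS family for the disk domain consists of the maps that enlarge the radius of a disk by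
  \<open>1 / (n + 1)\<close> if the disk lies in the open ball of radius \<open>n\<close> around the origin, and send
  all other disks to the whole plane (\<open>Disk_fs_poset\<close>). Finite separation is total boundedness of the
  set of centre-radius pairs. Such a family extends to the poset with a new greatest element
  (\<open>fs_poset_adjoin_top\<close>).

  For the negative half, the tie is a retract of the function space, via constant maps and evaluation
  at a point, so an FS family on the function space would yield maps below the identity of the tie that are
  finitely separated from it and directed with supremum the identity. One of them fixes the atoms \<open>a\<^sub>1\<close> and \<open>b\<^sub>1\<close>. Since
  \<open>a\<^sub>n\<close> and \<open>b\<^sub>n\<close> have no common upper bound strictly below \<open>a\<^bsub>n+1\<^esub>\<close> or \<open>b\<^bsub>n+1\<^esub>\<close>, it then fixes every \<open>a\<^sub>n\<close>
  and \<open>b\<^sub>n\<close>, which forces all of them into the finite separating set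
  (\<open>function_space_not_FS\<close>).
\<close>

section \<open>Directed suprema\<close>

lemma partial_orderI:
  assumes "eq D = (=)"
    and "\<And>x. x \<in> carrier D \<Longrightarrow> x \<sqsubseteq>\<^bsub>D\<^esub> x"
    and "\<And>x y. x \<in> carrier D \<Longrightarrow> y \<in> carrier D \<Longrightarrow> x \<sqsubseteq>\<^bsub>D\<^esub> y \<Longrightarrow> y \<sqsubseteq>\<^bsub>D\<^esub> x \<Longrightarrow> x = y"
    and "\<And>x y z. x \<in> carrier D \<Longrightarrow> y \<in> carrier D \<Longrightarrow> z \<in> carrier D \<Longrightarrow>
      x \<sqsubseteq>\<^bsub>D\<^esub> y \<Longrightarrow> y \<sqsubseteq>\<^bsub>D\<^esub> z \<Longrightarrow> x \<sqsubseteq>\<^bsub>D\<^esub> z"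
  shows "partial_order D"
  by unfold_locales (auto simp: assms(1) intro: assms(2-))

lemma po_refl: "partial_order D \<Longrightarrow> x \<in> carrier D \<Longrightarrow> x \<sqsubseteq>\<^bsub>D\<^esub> x"
  by (simp add: partial_order_def weak_partial_order.le_refl)

lemma po_trans:
  assumes "partial_order D" "x \<sqsubseteq>\<^bsub>D\<^esub> y" "y \<sqsubseteq>\<^bsub>D\<^esub> z"
    and "x \<in> carrier D" "y \<in> carrier D" "z \<in> carrier D"
  shows "x \<sqsubseteq>\<^bsub>D\<^esub> z"
  using assms weak_partial_order.le_trans partial_order_def by metis

lemma po_antisym:
  assumes "partial_order D" "x \<sqsubseteq>\<^bsub>D\<^esub> y" "y \<sqsubseteq>\<^bsub>D\<^esub> x" "x \<in> carrier D" "y \<in> carrier D"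
  shows "x = y"
  using assms partial_order.le_antisym by metis

lemma po_weak: "partial_order D \<Longrightarrow> weak_partial_order D"
  by (simp add: partial_order_def)

lemma is_sup_iff:
  assumes "A \<subseteq> carrier D"
  shows "is_sup D s A \<longleftrightarrow> s \<in> carrier D \<and> (\<forall>x\<in>A. x \<sqsubseteq>\<^bsub>D\<^esub> s) \<and>
    (\<forall>u\<in>carrier D. (\<forall>x\<in>A. x \<sqsubseteq>\<^bsub>D\<^esub> u) \<longrightarrow> s \<sqsubseteq>\<^bsub>D\<^esub> u)"
proof -
  have "x \<in> A \<and> x \<in> carrier D \<longleftrightarrow> x \<in> A" for x using assms by blast
  then show ?thesis unfolding is_sup_def least_def Upper_def by auto
qed

lemma is_supI:
  assumes "A \<subseteq> carrier D" "s \<in> carrier D" "\<And>x. x \<in> A \<Longrightarrow> x \<sqsubseteq>\<^bsub>D\<^esub> s"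
    and "\<And>u. u \<in> carrier D \<Longrightarrow> (\<And>x. x \<in> A \<Longrightarrow> x \<sqsubseteq>\<^bsub>D\<^esub> u) \<Longrightarrow> s \<sqsubseteq>\<^bsub>D\<^esub> u"
  shows "is_sup D s A"
  using assms by (auto simp: is_sup_iff)

lemma is_sup_carrier: "is_sup D s A \<Longrightarrow> s \<in> carrier D"
  unfolding is_sup_def least_def Upper_def by auto

lemma is_sup_upper: "is_sup D s A \<Longrightarrow> A \<subseteq> carrier D \<Longrightarrow> x \<in> A \<Longrightarrow> x \<sqsubseteq>\<^bsub>D\<^esub> s"
  by (simp add: is_sup_iff)

lemma is_sup_least:
  "is_sup D s A \<Longrightarrow> A \<subseteq> carrier D \<Longrightarrow> u \<in> carrier D \<Longrightarrow> (\<And>x. x \<in> A \<Longrightarrow> x \<sqsubseteq>\<^bsub>D\<^esub> u) \<Longrightarrow> s \<sqsubseteq>\<^bsub>D\<^esub> u"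
  by (simp add: is_sup_iff)

lemma is_sup_unique: "partial_order D \<Longrightarrow> is_sup D s A \<Longrightarrow> is_sup D t A \<Longrightarrow> s = t"
  unfolding is_sup_def using partial_order.least_unique by metis

lemma directed_carrier: "directed D A \<Longrightarrow> A \<subseteq> carrier D"
  by (simp add: directed_def)

lemma directed_bound: "directed D A \<Longrightarrow> x \<in> A \<Longrightarrow> y \<in> A \<Longrightarrow> \<exists>z\<in>A. x \<sqsubseteq>\<^bsub>D\<^esub> z \<and> y \<sqsubseteq>\<^bsub>D\<^esub> z"
  by (simp add: directed_def)

lemma directed_finite_bound:
  assumes "partial_order D" "directed D A" "finite X" "X \<subseteq> A"
  shows "\<exists>z\<in>A. \<forall>x\<in>X. x \<sqsubseteq>\<^bsub>D\<^esub> z"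
  using assms(3,4)
proof (induction X rule: finite_induct)
  case empty
  then show ?case using assms(2) by (auto simp: directed_def)
next
  case (insert x X)
  then obtain z where z: "z \<in> A" "\<forall>x\<in>X. x \<sqsubseteq>\<^bsub>D\<^esub> z" by auto
  obtain w where w: "w \<in> A" "x \<sqsubseteq>\<^bsub>D\<^esub> w" "z \<sqsubseteq>\<^bsub>D\<^esub> w"
    using directed_bound[OF assms(2), of x z] insert.prems z(1) by auto
  have "y \<sqsubseteq>\<^bsub>D\<^esub> w" if "y \<in> X" for y
    using po_trans[OF assms(1), of y z w] z w that insert.prems directed_carrier[OF assms(2)]
    by blast
  then show ?case using w by auto
qed

text \<open>The form in which directedness is used: finitely many upward closed conditions,
  each met somewhere in \<open>A\<close>, are met simultaneously by one element of \<open>A\<close>.\<close>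

lemma directed_collect:
  assumes po: "partial_order D" and dir: "directed D A" and "finite X"
    and ex: "\<And>m. m \<in> X \<Longrightarrow> \<exists>y\<in>A. P m y"
    and up: "\<And>m y z. m \<in> X \<Longrightarrow> y \<in> A \<Longrightarrow> z \<in> A \<Longrightarrow> y \<sqsubseteq>\<^bsub>D\<^esub> z \<Longrightarrow> P m y \<Longrightarrow> P m z"
  shows "\<exists>z\<in>A. \<forall>m\<in>X. P m z"
proof -
  obtain w where w: "\<And>m. m \<in> X \<Longrightarrow> w m \<in> A \<and> P m (w m)" using ex by metis
  obtain z where "z \<in> A" "\<forall>x\<in>w ` X. x \<sqsubseteq>\<^bsub>D\<^esub> z"
    using directed_finite_bound[OF po dir, of "w ` X"] w \<open>finite X\<close> by blast
  then show ?thesis using up w by blast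
qed

lemma is_sup_greatest:
  assumes "A \<subseteq> carrier D" "m \<in> A" "\<And>x. x \<in> A \<Longrightarrow> x \<sqsubseteq>\<^bsub>D\<^esub> m"
  shows "is_sup D m A"
  using assms by (auto simp: is_sup_iff)

lemma way_below_imp_le:
  assumes po: "partial_order D" and wb: "way_below D a x"
  shows "a \<sqsubseteq>\<^bsub>D\<^esub> x"
proof -
  have x: "x \<in> carrier D" using wb by (simp add: way_below_def)
  have "directed D {x}" "is_sup D x {x}"
    using x po_refl[OF po x] by (auto simp: directed_def is_sup_iff)
  then show ?thesis using wb po_refl[OF po x] unfolding way_below_def by blast
qed

text \<open>Continuity may be tested on any directed set of approximants: it is cofinal in the set of
  all elements way below \<open>x\<close>, since each of those lies below one of its members.\<close>

lemma continuous_dcpoI: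
  assumes D: "dcpo D"
    and B: "\<And>x. x \<in> carrier D \<Longrightarrow>
      \<exists>B. directed D B \<and> is_sup D x B \<and> (\<forall>b\<in>B. way_below D b x)"
  shows "continuous_dcpo D"
  unfolding continuous_dcpo_def
proof (intro conjI ballI)
  show "dcpo D" by (rule D)
  have po: "partial_order D" using D by (simp add: dcpo_def)
  fix x assume x: "x \<in> carrier D"
  obtain B where B: "directed D B" "is_sup D x B" "\<And>b. b \<in> B \<Longrightarrow> way_below D b x"
    using B[OF x] by blast
  let ?W = "{a \<in> carrier D. way_below D a x}"
  have sub: "B \<subseteq> ?W" using B(3) directed_carrier[OF B(1)] by auto
  have cof: "\<exists>b\<in>B. a \<sqsubseteq>\<^bsub>D\<^esub> b" if "a \<in> ?W" for a
    using that B(1,2) po_refl[OF po x] unfolding way_below_def by blast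
  show "directed D ?W"
    unfolding directed_def
  proof (intro conjI ballI)
    show "?W \<noteq> {}" using sub B(1) by (auto simp: directed_def)
    fix a a' assume a: "a \<in> ?W" and a': "a' \<in> ?W"
    obtain b b' where b: "b \<in> B" "a \<sqsubseteq>\<^bsub>D\<^esub> b" "b' \<in> B" "a' \<sqsubseteq>\<^bsub>D\<^esub> b'"
      using cof[OF a] cof[OF a'] by blast
    obtain c where c: "c \<in> B" "b \<sqsubseteq>\<^bsub>D\<^esub> c" "b' \<sqsubseteq>\<^bsub>D\<^esub> c"
      using directed_bound[OF B(1) b(1,3)] by blast
    have "a \<sqsubseteq>\<^bsub>D\<^esub> c" "a' \<sqsubseteq>\<^bsub>D\<^esub> c"
      using po_trans[OF po b(2) c(2)] po_trans[OF po b(4) c(3)] a a' b c sub by auto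
    then show "\<exists>c\<in>?W. a \<sqsubseteq>\<^bsub>D\<^esub> c \<and> a' \<sqsubseteq>\<^bsub>D\<^esub> c" using c sub by blast
  qed auto
  show "is_sup D x ?W"
  proof (rule is_supI)
    fix u assume "u \<in> carrier D" "\<And>a. a \<in> ?W \<Longrightarrow> a \<sqsubseteq>\<^bsub>D\<^esub> u"
    then show "x \<sqsubseteq>\<^bsub>D\<^esub> u"
      using is_sup_least[OF B(2) directed_carrier[OF B(1)]] sub by blast
  qed (use x way_below_imp_le[OF po] in auto)
qed

section \<open>Scott-continuous maps\<close>

lemma scott_continuous_carrier: "scott_continuous D E f \<Longrightarrow> x \<in> carrier D \<Longrightarrow> f x \<in> carrier E"
  by (auto simp: scott_continuous_def)

lemma scott_continuous_mono:
  "scott_continuous D E f \<Longrightarrow> x \<in> carrier D \<Longrightarrow> y \<in> carrier D \<Longrightarrow> x \<sqsubseteq>\<^bsub>D\<^esub> y \<Longrightarrow> f x \<sqsubseteq>\<^bsub>E\<^esub> f y"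
  by (auto simp: scott_continuous_def isotone_def)

lemma scott_continuous_sup:
  "scott_continuous D E f \<Longrightarrow> directed D A \<Longrightarrow> is_sup D s A \<Longrightarrow> is_sup E (f s) (f ` A)"
  by (auto simp: scott_continuous_def)

lemma scott_continuousI:
  assumes "partial_order D" "partial_order E"
    and "\<And>x. x \<in> carrier D \<Longrightarrow> f x \<in> carrier E"
    and "\<And>x y. x \<in> carrier D \<Longrightarrow> y \<in> carrier D \<Longrightarrow> x \<sqsubseteq>\<^bsub>D\<^esub> y \<Longrightarrow> f x \<sqsubseteq>\<^bsub>E\<^esub> f y"
    and "\<And>A s. directed D A \<Longrightarrow> is_sup D s A \<Longrightarrow> is_sup E (f s) (f ` A)"
  shows "scott_continuous D E f"
  using assms by (auto simp: scott_continuous_def isotone_def po_weak)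

lemma directed_image:
  assumes A: "directed D A"
    and "\<And>x. x \<in> A \<Longrightarrow> f x \<in> carrier E"
    and mono: "\<And>x y. x \<in> A \<Longrightarrow> y \<in> A \<Longrightarrow> x \<sqsubseteq>\<^bsub>D\<^esub> y \<Longrightarrow> f x \<sqsubseteq>\<^bsub>E\<^esub> f y"
  shows "directed E (f ` A)"
  unfolding directed_def
proof (intro conjI ballI)
  fix a b assume "a \<in> f ` A" "b \<in> f ` A"
  then obtain x y where xy: "x \<in> A" "a = f x" "y \<in> A" "b = f y" by blast
  then obtain z where "z \<in> A" "x \<sqsubseteq>\<^bsub>D\<^esub> z" "y \<sqsubseteq>\<^bsub>D\<^esub> z" using directed_bound[OF A] by blast
  then show "\<exists>c\<in>f ` A. a \<sqsubseteq>\<^bsub>E\<^esub> c \<and> b \<sqsubseteq>\<^bsub>E\<^esub> c" using xy mono by blast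
qed (use assms in \<open>auto simp: directed_def\<close>)

lemma scott_continuous_directed:
  assumes "scott_continuous D E f" "directed D A"
  shows "directed E (f ` A)"
  using directed_image[OF assms(2), of f E] scott_continuous_mono[OF assms(1)]
    scott_continuous_carrier[OF assms(1)] directed_carrier[OF assms(2)] by blast

lemma scott_continuous_comp:
  assumes "partial_order D" "partial_order E'"
    and f: "scott_continuous D E f" and g: "scott_continuous E E' g"
  shows "scott_continuous D E' (\<lambda>x. g (f x))"
proof (rule scott_continuousI[OF assms(1,2)])
  fix A s assume "directed D A" "is_sup D s A"
  then have "is_sup E' (g (f s)) (g ` f ` A)"
    by (intro scott_continuous_sup[OF g] scott_continuous_directed[OF f] scott_continuous_sup[OF f])
  then show "is_sup E' (g (f s)) ((\<lambda>x. g (f x)) ` A)" by (simp add: image_image)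
qed (auto intro: scott_continuous_mono[OF g] scott_continuous_mono[OF f]
      scott_continuous_carrier[OF g] scott_continuous_carrier[OF f])

lemma scott_continuous_restrict:
  assumes "scott_continuous D E f"
  shows "scott_continuous D E (restrict f (carrier D))"
  unfolding scott_continuous_def
proof (intro conjI allI impI)
  fix A s assume A: "directed D A \<and> is_sup D s A"
  have "restrict f (carrier D) ` A = f ` A"
    using directed_carrier A by (intro image_cong) auto
  then show "is_sup E (restrict f (carrier D) s) (restrict f (carrier D) ` A)"
    using scott_continuous_sup[OF assms, of A s] is_sup_carrier[of D s A] A by simp
qed (use assms in \<open>auto simp: scott_continuous_def isotone_def\<close>)

lemma scott_continuous_const:
  assumes "partial_order D" "partial_order E" "c \<in> carrier E"
  shows "scott_continuous D E (\<lambda>_. c)"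
proof (rule scott_continuousI[OF assms(1,2)])
  fix A s assume "directed D A"
  then have "(\<lambda>_. c) ` A = {c}" by (auto simp: directed_def)
  then show "is_sup E c ((\<lambda>_. c) ` A)"
    using assms(3) po_refl[OF assms(2,3)] by (auto simp: is_sup_iff)
qed (use assms(3) po_refl[OF assms(2,3)] in auto)

section \<open>The Scott function space\<close>

lemma scott_space_carrier:
  "f \<in> carrier (scott_space D E) \<longleftrightarrow> f \<in> extensional (carrier D) \<and> scott_continuous D E f"
  unfolding scott_space_def by (auto simp: PiE_def scott_continuous_def)

lemma scott_space_le: "f \<sqsubseteq>\<^bsub>scott_space D E\<^esub> g \<longleftrightarrow> (\<forall>x\<in>carrier D. f x \<sqsubseteq>\<^bsub>E\<^esub> g x)"
  by (simp add: scott_space_def)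

lemma scott_space_restrict:
  "scott_continuous D E f \<Longrightarrow> restrict f (carrier D) \<in> carrier (scott_space D E)"
  by (simp add: scott_space_carrier scott_continuous_restrict)

lemma scott_space_apply:
  "f \<in> carrier (scott_space D E) \<Longrightarrow> x \<in> carrier D \<Longrightarrow> f x \<in> carrier E"
  by (auto simp: scott_space_carrier scott_continuous_carrier)

lemma scott_space_partial_order:
  assumes E: "partial_order E"
  shows "partial_order (scott_space D E)"
proof (rule partial_orderI)
  show "eq (scott_space D E) = (=)" by (simp add: scott_space_def)
next
  fix f assume "f \<in> carrier (scott_space D E)"
  then show "f \<sqsubseteq>\<^bsub>scott_space D E\<^esub> f" using po_refl[OF E] by (auto simp: scott_space_le scott_space_apply)
next
  fix f g assume fg: "f \<in> carrier (scott_space D E)" "g \<in> carrier (scott_space D E)"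
    "f \<sqsubseteq>\<^bsub>scott_space D E\<^esub> g" "g \<sqsubseteq>\<^bsub>scott_space D E\<^esub> f"
  show "f = g"
  proof (rule extensionalityI)
    fix x assume "x \<in> carrier D"
    then show "f x = g x"
      using fg po_antisym[OF E] by (auto simp: scott_space_le scott_space_apply)
  qed (use fg in \<open>auto simp: scott_space_carrier\<close>)
next
  fix f g h assume fgh: "f \<in> carrier (scott_space D E)" "g \<in> carrier (scott_space D E)"
    "h \<in> carrier (scott_space D E)" "f \<sqsubseteq>\<^bsub>scott_space D E\<^esub> g" "g \<sqsubseteq>\<^bsub>scott_space D E\<^esub> h"
  show "f \<sqsubseteq>\<^bsub>scott_space D E\<^esub> h"
    unfolding scott_space_le
  proof
    fix x assume "x \<in> carrier D"
    then show "f x \<sqsubseteq>\<^bsub>E\<^esub> h x"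
      using fgh po_trans[OF E, of "f x" "g x" "h x"] by (auto simp: scott_space_le scott_space_apply)
  qed
qed

lemma scott_space_eval_directed:
  assumes "directed (scott_space D E) G" "x \<in> carrier D"
  shows "directed E ((\<lambda>g. g x) ` G)"
  using assms directed_carrier[OF assms(1)]
  by (intro directed_image[OF assms(1)]) (auto simp: scott_space_le scott_space_apply)

text \<open>A pointwise supremum of Scott-continuous maps is Scott-continuous because suprema commute
  with suprema; this makes the function space a dcpo and its suprema pointwise.\<close>

lemma scott_space_pointwise_sup:
  assumes D: "partial_order D" and E: "dcpo E" and G: "directed (scott_space D E) G"
  obtains h where "is_sup (scott_space D E) h G" "\<And>x. x \<in> carrier D \<Longrightarrow> is_sup E (h x) ((\<lambda>g. g x) ` G)"
proof -
  have poE: "partial_order E" using E by (simp add: dcpo_def)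
  have "\<exists>s. is_sup E s ((\<lambda>g. g x) ` G)" if "x \<in> carrier D" for x
    using E scott_space_eval_directed[OF G that] by (auto simp: dcpo_def)
  then obtain h0 where h0: "\<And>x. x \<in> carrier D \<Longrightarrow> is_sup E (h0 x) ((\<lambda>g. g x) ` G)" by metis
  define h where "h = restrict h0 (carrier D)"
  have h: "is_sup E (h x) ((\<lambda>g. g x) ` G)" if "x \<in> carrier D" for x
    using h0[OF that] that by (simp add: h_def)
  have GC: "g \<in> carrier (scott_space D E)" if "g \<in> G" for g
    using that directed_carrier[OF G] by blast
  have sc: "scott_continuous D E g" if "g \<in> G" for g
    using GC[OF that] by (simp add: scott_space_carrier)
  have sub: "(\<lambda>g. g x) ` G \<subseteq> carrier E" if "x \<in> carrier D" for x
    using GC that by (auto intro: scott_space_apply)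
  have hc: "h x \<in> carrier E" if "x \<in> carrier D" for x
    using h[OF that] is_sup_carrier by metis
  have ub: "g x \<sqsubseteq>\<^bsub>E\<^esub> h x" if "x \<in> carrier D" "g \<in> G" for x g
    using is_sup_upper[OF h[OF that(1)] sub[OF that(1)]] that(2) by blast
  have lub: "h x \<sqsubseteq>\<^bsub>E\<^esub> u" if "x \<in> carrier D" "u \<in> carrier E" "\<And>g. g \<in> G \<Longrightarrow> g x \<sqsubseteq>\<^bsub>E\<^esub> u" for x u
    using is_sup_least[OF h[OF that(1)] sub[OF that(1)] that(2)] that(3) by blast
  have mono: "h x \<sqsubseteq>\<^bsub>E\<^esub> h y" if "x \<in> carrier D" "y \<in> carrier D" "x \<sqsubseteq>\<^bsub>D\<^esub> y" for x y
  proof (rule lub)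
    fix g assume g: "g \<in> G"
    show "g x \<sqsubseteq>\<^bsub>E\<^esub> h y"
      using po_trans[OF poE scott_continuous_mono[OF sc[OF g] that] ub[OF that(2) g]]
        that hc scott_space_apply[OF GC[OF g]] by blast
  qed (use that hc in auto)
  have "scott_continuous D E h"
  proof (rule scott_continuousI[OF D poE hc mono])
    fix A s assume A: "directed D A" and s: "is_sup D s A"
    have AC: "A \<subseteq> carrier D" and sC: "s \<in> carrier D"
      using directed_carrier[OF A] is_sup_carrier[OF s] .
    show "is_sup E (h s) (h ` A)"
    proof (rule is_supI)
      fix y assume "y \<in> h ` A"
      then show "y \<sqsubseteq>\<^bsub>E\<^esub> h s" using mono AC sC is_sup_upper[OF s AC] by auto
    next
      fix u assume u: "u \<in> carrier E" "\<And>y. y \<in> h ` A \<Longrightarrow> y \<sqsubseteq>\<^bsub>E\<^esub> u"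
      show "h s \<sqsubseteq>\<^bsub>E\<^esub> u"
      proof (rule lub[OF sC u(1)])
        fix g assume g: "g \<in> G"
        have gA: "g ` A \<subseteq> carrier E" using scott_space_apply[OF GC[OF g]] AC by blast
        show "g s \<sqsubseteq>\<^bsub>E\<^esub> u"
        proof (rule is_sup_least[OF scott_continuous_sup[OF sc[OF g] A s] gA u(1)])
          fix y assume "y \<in> g ` A"
          then obtain a where a: "a \<in> A" "y = g a" by blast
          then show "y \<sqsubseteq>\<^bsub>E\<^esub> u"
            using po_trans[OF poE ub[of a g] u(2)[of "h a"]] g gA AC hc u(1) by blast
        qed
      qed
    qed (use AC sC hc in auto)
  qed
  then have hS: "h \<in> carrier (scott_space D E)" by (simp add: scott_space_carrier h_def)
  have "is_sup (scott_space D E) h G"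
    by (rule is_supI[OF directed_carrier[OF G] hS]) (auto simp: scott_space_le intro: ub lub scott_space_apply)
  with h show ?thesis using that by blast
qed

lemma scott_space_dcpo:
  assumes "partial_order D" "dcpo E"
  shows "dcpo (scott_space D E)"
  using assms scott_space_partial_order scott_space_pointwise_sup[OF assms] unfolding dcpo_def by metis

lemma scott_space_sup_eval:
  assumes "partial_order D" "dcpo E" "directed (scott_space D E) G"
    and "is_sup (scott_space D E) s G" "x \<in> carrier D"
  shows "is_sup E (s x) ((\<lambda>g. g x) ` G)"
proof -
  obtain h where h: "is_sup (scott_space D E) h G" "is_sup E (h x) ((\<lambda>g. g x) ` G)"
    using scott_space_pointwise_sup[OF assms(1-3)] assms(5) by metis
  have "partial_order (scott_space D E)"
    using assms(2) by (simp add: dcpo_def scott_space_partial_order)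
  then have "s = h" using is_sup_unique assms(4) h(1) by metis
  then show ?thesis using h(2) by simp
qed

section \<open>Plotkin's tie\<close>

text \<open>On the carrier the order is determined by this level: two distinct elements are comparable
  precisely when their levels differ (see \<open>tie_le_iff\<close>).\<close>

fun level :: "tie \<Rightarrow> enat" where
  "level Tie_bot = 0"
| "level Tie_top = \<infinity>"
| "level (Tie_elt u n) = enat n"

lemma tie_carrier: "x \<in> carrier plotkin_tie \<longleftrightarrow> (\<forall>u. x \<noteq> Tie_elt u 0)"
  by (cases x) (auto simp: plotkin_tie_def Suc_le_eq)

lemma tie_le_iff:
  assumes "x \<in> carrier plotkin_tie" "y \<in> carrier plotkin_tie"
  shows "x \<sqsubseteq>\<^bsub>plotkin_tie\<^esub> y \<longleftrightarrow> x = y \<or> level x < level y"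
  using assms by (cases x; cases y) (auto simp: plotkin_tie_def zero_enat_def)

lemma tie_partial_order: "partial_order plotkin_tie"
proof (rule partial_orderI)
  show "eq plotkin_tie = (=)" by (simp add: plotkin_tie_def)
qed (auto simp: tie_le_iff)

lemma level_eq_top: "level x = \<infinity> \<longleftrightarrow> x = Tie_top"
  by (cases x) auto

lemma level_mono:
  assumes "x \<sqsubseteq>\<^bsub>plotkin_tie\<^esub> y" "x \<in> carrier plotkin_tie" "y \<in> carrier plotkin_tie"
  shows "level x \<le> level y"
  using assms by (auto simp: tie_le_iff)

lemma tie_le_top: "x \<in> carrier plotkin_tie \<Longrightarrow> x \<sqsubseteq>\<^bsub>plotkin_tie\<^esub> Tie_top"
  using level_eq_top by (auto simp: tie_le_iff tie_carrier)

lemma finite_level_less: "finite {x. level x < enat n}"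
proof (rule finite_subset)
  have "(UNIV :: tie_letter set) = {La, Lb}" using tie_letter.exhaust by blast
  then have "finite (UNIV :: tie_letter set)" by (metis finite.emptyI finite.insertI)
  then show "finite (insert Tie_bot ((\<lambda>(u, k). Tie_elt u k) ` (UNIV \<times> {..<n})))" by simp
  show "{x. level x < enat n} \<subseteq> insert Tie_bot ((\<lambda>(u, k). Tie_elt u k) ` (UNIV \<times> {..<n}))"
  proof
    fix x assume "x \<in> {x. level x < enat n}"
    then show "x \<in> insert Tie_bot ((\<lambda>(u, k). Tie_elt u k) ` (UNIV \<times> {..<n}))" by (cases x) auto
  qed
qed

text \<open>A directed set of bounded level is finite, because each level has at most two
  elements; a directed set of unbounded level has no upper bound but \<open>\<top>\<close>.\<close>

lemma tie_directed_cases: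
  assumes A: "directed plotkin_tie A"
  obtains (greatest) m where "m \<in> A" "\<And>x. x \<in> A \<Longrightarrow> x \<sqsubseteq>\<^bsub>plotkin_tie\<^esub> m" "is_sup plotkin_tie m A"
  | (unbounded) "\<And>n. \<exists>x\<in>A. enat n \<le> level x" "is_sup plotkin_tie Tie_top A"
proof (cases "\<forall>n. \<exists>x\<in>A. enat n \<le> level x")
  case True
  have AC: "A \<subseteq> carrier plotkin_tie" by (rule directed_carrier[OF A])
  have "is_sup plotkin_tie Tie_top A"
  proof (rule is_supI[OF AC])
    fix u assume u: "u \<in> carrier plotkin_tie" "\<And>x. x \<in> A \<Longrightarrow> x \<sqsubseteq>\<^bsub>plotkin_tie\<^esub> u"
    have "enat n \<le> level u" for n
    proof -
      obtain x where "x \<in> A" "enat n \<le> level x" using True by blast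
      then show ?thesis using level_mono[OF u(2)] AC u(1) by fastforce
    qed
    then have "level u = \<infinity>" by (metis enat_ord_simps(1) not_infinity_eq Suc_n_not_le_n)
    then show "Tie_top \<sqsubseteq>\<^bsub>plotkin_tie\<^esub> u" using u(1) level_eq_top by (simp add: tie_le_iff)
  qed (use AC tie_le_top in \<open>auto simp: tie_carrier\<close>)
  then show ?thesis using True unbounded by blast
next
  case False
  then obtain n where "A \<subseteq> {x. level x < enat n}" by (auto simp: not_le)
  then have "finite A" using finite_level_less finite_subset by blast
  then obtain m where "m \<in> A" "\<forall>x\<in>A. x \<sqsubseteq>\<^bsub>plotkin_tie\<^esub> m"
    using directed_finite_bound[OF tie_partial_order A] by blast
  then show ?thesis using greatest is_sup_greatest[OF directed_carrier[OF A]] by blast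
qed

lemma tie_dcpo: "dcpo plotkin_tie"
  unfolding dcpo_def using tie_partial_order tie_directed_cases by metis

text \<open>Every element except \<open>\<top>\<close> is compact: a directed set reaches its supremum
  unless its levels are unbounded, and then it passes every finite level.\<close>

lemma tie_compact:
  assumes A: "directed plotkin_tie A" and s: "is_sup plotkin_tie s A"
    and c: "c \<in> carrier plotkin_tie" "c \<noteq> Tie_top" "c \<sqsubseteq>\<^bsub>plotkin_tie\<^esub> s"
  shows "\<exists>x\<in>A. c \<sqsubseteq>\<^bsub>plotkin_tie\<^esub> x"
  using A
proof (cases rule: tie_directed_cases)
  case (greatest m)
  then show ?thesis using c(3) is_sup_unique[OF tie_partial_order s] by blast
next
  case unbounded
  obtain k where k: "level c = enat k" using c(2) level_eq_top by (metis not_infinity_eq)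
  obtain x where "x \<in> A" "enat (Suc k) \<le> level x" using unbounded by blast
  then have "level c < level x" using k by (metis Suc_ile_eq)
  then show ?thesis using \<open>x \<in> A\<close> c(1) directed_carrier[OF A] tie_le_iff by blast
qed

lemma tie_le_by_compacts:
  assumes t: "t \<in> carrier plotkin_tie" "t' \<in> carrier plotkin_tie"
    and le: "\<And>c. c \<in> carrier plotkin_tie \<Longrightarrow> c \<noteq> Tie_top \<Longrightarrow> c \<sqsubseteq>\<^bsub>plotkin_tie\<^esub> t \<Longrightarrow> c \<sqsubseteq>\<^bsub>plotkin_tie\<^esub> t'"
  shows "t \<sqsubseteq>\<^bsub>plotkin_tie\<^esub> t'"
proof (cases "t = Tie_top")
  case True
  have "enat (Suc n) \<le> level t'" for n
    using level_mono[of "Tie_elt La (Suc n)" t'] le[of "Tie_elt La (Suc n)"] t tie_le_top True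
    by (auto simp: tie_carrier)
  then have "level t' = \<infinity>" by (metis enat_ord_simps(1) not_infinity_eq Suc_n_not_le_n)
  then show ?thesis using True t level_eq_top by (simp add: tie_le_iff)
next
  case False
  then show ?thesis using le t po_refl[OF tie_partial_order] by blast
qed

text \<open>The choice of \<open>La\<close> is arbitrary, but some letter has to be chosen, and truncation is not below
  the identity: a monotone map below the identity that fixes both elements of level \<open>1\<close> fixes all
  elements of finite level, so it has unbounded values.\<close>

definition truncate :: "nat \<Rightarrow> tie \<Rightarrow> tie" where
  "truncate N x = (if level x < enat N then x else Tie_elt La N)"

lemma truncate_carrier: "N \<ge> 1 \<Longrightarrow> x \<in> carrier plotkin_tie \<Longrightarrow> truncate N x \<in> carrier plotkin_tie"
  by (auto simp: truncate_def tie_carrier)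

lemma level_truncate: "level (truncate N x) = min (level x) (enat N)"
  by (auto simp: truncate_def min_def)

text \<open>Truncation turns a directed set of unbounded level into one that attains its
  supremum.\<close>

lemma truncate_scott_continuous:
  assumes N: "N \<ge> 1"
  shows "scott_continuous plotkin_tie plotkin_tie (truncate N)"
proof -
  have mono: "truncate N x \<sqsubseteq>\<^bsub>plotkin_tie\<^esub> truncate N y"
    if xy: "x \<in> carrier plotkin_tie" "y \<in> carrier plotkin_tie" "x \<sqsubseteq>\<^bsub>plotkin_tie\<^esub> y" for x y
  proof -
    have "x = y \<or> level x < level y" using xy tie_le_iff by blast
    then show ?thesis
      using truncate_carrier[OF N xy(1)] truncate_carrier[OF N xy(2)] by (auto simp: tie_le_iff truncate_def)
  qed
  show ?thesis
  proof (rule scott_continuousI[OF tie_partial_order tie_partial_order truncate_carrier[OF N] mono])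
    fix A s assume A: "directed plotkin_tie A" and s: "is_sup plotkin_tie s A"
    have AC: "A \<subseteq> carrier plotkin_tie" by (rule directed_carrier[OF A])
    have sC: "s \<in> carrier plotkin_tie" by (rule is_sup_carrier[OF s])
    have "\<exists>x\<in>A. truncate N x = truncate N s"
      using A
    proof (cases rule: tie_directed_cases)
      case (greatest m)
      then show ?thesis using is_sup_unique[OF tie_partial_order s] by blast
    next
      case unbounded
      then have "s = Tie_top" using is_sup_unique[OF tie_partial_order s] by blast
      moreover obtain x where "x \<in> A" "enat N \<le> level x" using unbounded by blast
      ultimately show ?thesis by (auto simp: truncate_def intro!: bexI[of _ x])
    qed
    then obtain x where x: "x \<in> A" "truncate N x = truncate N s" by blast
    show "is_sup plotkin_tie (truncate N s) (truncate N ` A)"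
    proof (rule is_sup_greatest)
      show "truncate N ` A \<subseteq> carrier plotkin_tie" using AC truncate_carrier[OF N] by blast
      show "truncate N s \<in> truncate N ` A" using x by (metis imageI)
      show "y \<sqsubseteq>\<^bsub>plotkin_tie\<^esub> truncate N s" if "y \<in> truncate N ` A" for y
        using that mono AC sC is_sup_upper[OF s AC] by blast
    qed
  qed
qed

section \<open>Continuity of the function space\<close>

definition separates :: "('a, 'b) gorder_scheme \<Rightarrow> 'a set \<Rightarrow> ('a \<Rightarrow> 'a) \<Rightarrow> bool" where
  "separates D M d \<longleftrightarrow> finite M \<and> M \<subseteq> carrier D \<and>
    (\<forall>x\<in>carrier D. \<exists>m\<in>M. d x \<sqsubseteq>\<^bsub>D\<^esub> m \<and> m \<sqsubseteq>\<^bsub>D\<^esub> x)"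

definition approximant :: "('a, 'b) gorder_scheme \<Rightarrow> ('a \<Rightarrow> tie) \<Rightarrow> ('a \<Rightarrow> 'a) \<Rightarrow> nat \<Rightarrow> 'a \<Rightarrow> tie" where
  "approximant D f d N = (\<lambda>x\<in>carrier D. truncate N (f (d x)))"

text \<open>The bound \<open>N\<close> lies above every level that \<open>f\<close> takes on the separating set without being \<open>\<top>\<close>
  there, so that truncation at \<open>N\<close> changes \<open>f (d x)\<close> only if \<open>f x\<close> is \<open>\<top>\<close>. The condition \<open>N \<ge> 1\<close> keeps
  the value \<open>Tie_elt La N\<close> in the carrier.\<close>

definition admissible :: "('a, 'b) gorder_scheme \<Rightarrow> ('a \<Rightarrow> tie) \<Rightarrow> ('a \<Rightarrow> 'a) \<Rightarrow> nat \<Rightarrow> 'a set \<Rightarrow> bool" where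
  "admissible D f d N M \<longleftrightarrow> N \<ge> 1 \<and> separates D M d \<and>
    (\<forall>m\<in>M. f m = Tie_top \<or> level (f m) < enat N)"

text \<open>The FS family is a parameter, not an existential witness, because the approximants of maps
  into the tie are built from it, and because it is transported from the disk domain to the extension by
  a top.\<close>

locale fs_poset =
  fixes D :: "('a, 'b) gorder_scheme" and F :: "('a \<Rightarrow> 'a) set"
  assumes po: "partial_order D"
    and dir: "directed (scott_space D D) F"
    and sep: "\<And>d. d \<in> F \<Longrightarrow> finitely_separated D d"
    and sup: "\<And>x. x \<in> carrier D \<Longrightarrow> is_sup D x ((\<lambda>d. d x) ` F)"
begin

lemma F_continuous: "d \<in> F \<Longrightarrow> scott_continuous D D d"
  using directed_carrier[OF dir] by (auto simp: scott_space_carrier)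

lemma F_carrier: "d \<in> F \<Longrightarrow> x \<in> carrier D \<Longrightarrow> d x \<in> carrier D"
  using F_continuous scott_continuous_carrier by metis

lemma F_le_id: "d \<in> F \<Longrightarrow> x \<in> carrier D \<Longrightarrow> d x \<sqsubseteq>\<^bsub>D\<^esub> x"
  using is_sup_upper[OF sup] F_carrier by blast

lemma admissible_exists:
  assumes "d \<in> F"
  shows "\<exists>N M. admissible D f d N M \<and> k < N"
proof -
  obtain M where M: "separates D M d"
    using sep[OF assms] unfolding finitely_separated_def separates_def by blast
  then have "finite M" by (simp add: separates_def)
  then have "\<exists>n. \<forall>m\<in>M. f m = Tie_top \<or> level (f m) < enat n"
  proof (induction M)
    case (insert m M)
    then obtain n where n: "\<forall>m\<in>M. f m = Tie_top \<or> level (f m) < enat n" by blast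
    have "\<exists>j. f m = Tie_top \<or> level (f m) < enat j"
      by (metis enat_ord_simps(2) less_Suc_eq level_eq_top not_infinity_eq)
    then obtain j where j: "f m = Tie_top \<or> level (f m) < enat j" by blast
    have "f m' = Tie_top \<or> level (f m') < enat (max j n)" if "m' \<in> insert m M" for m'
    proof -
      have "enat j \<le> enat (max j n)" "enat n \<le> enat (max j n)" by auto
      then show ?thesis using that j n less_le_trans by blast
    qed
    then show ?case by blast
  qed auto
  then obtain n where n: "\<forall>m\<in>M. f m = Tie_top \<or> level (f m) < enat n" by blast
  have "f m = Tie_top \<or> level (f m) < enat (Suc (max n k))" if "m \<in> M" for m
  proof -
    have "enat n \<le> enat (Suc (max n k))" by simp
    then show ?thesis using n that less_le_trans by blast
  qed
  then have "admissible D f d (Suc (max n k)) M" using M by (simp add: admissible_def)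
  then show ?thesis by (metis less_Suc_eq_le max.cobounded2)
qed

abbreviation "S \<equiv> scott_space D plotkin_tie"

definition "approximants f = {approximant D f d N | d N M. d \<in> F \<and> admissible D f d N M}"

context
  fixes f :: "'a \<Rightarrow> tie"
  assumes f: "f \<in> carrier (scott_space D plotkin_tie)"
begin

lemma f_continuous: "scott_continuous D plotkin_tie f"
  using f by (simp add: scott_space_carrier)

lemma f_carrier: "x \<in> carrier D \<Longrightarrow> f x \<in> carrier plotkin_tie"
  using f by (rule scott_space_apply)

lemma fd_carrier: "d \<in> F \<Longrightarrow> x \<in> carrier D \<Longrightarrow> f (d x) \<in> carrier plotkin_tie"
  using f_carrier F_carrier by blast

lemma f_mono: "x \<in> carrier D \<Longrightarrow> y \<in> carrier D \<Longrightarrow> x \<sqsubseteq>\<^bsub>D\<^esub> y \<Longrightarrow> f x \<sqsubseteq>\<^bsub>plotkin_tie\<^esub> f y"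
  using scott_continuous_mono[OF f_continuous] .

lemma level_f_mono: "x \<in> carrier D \<Longrightarrow> y \<in> carrier D \<Longrightarrow> x \<sqsubseteq>\<^bsub>D\<^esub> y \<Longrightarrow> level (f x) \<le> level (f y)"
  using level_mono[OF f_mono f_carrier f_carrier] by blast

lemma level_fd_mono:
  assumes "d \<in> F" "e \<in> F" "d \<sqsubseteq>\<^bsub>scott_space D D\<^esub> e" "x \<in> carrier D"
  shows "level (f (d x)) \<le> level (f (e x))"
  using assms level_f_mono[OF F_carrier[OF assms(1,4)] F_carrier[OF assms(2,4)]]
  by (auto simp: scott_space_le)

lemma approximant_carrier:
  assumes "d \<in> F" "N \<ge> 1"
  shows "approximant D f d N \<in> carrier S"
  unfolding approximant_def
  by (intro scott_space_restrict
      scott_continuous_comp[OF po tie_partial_order _ truncate_scott_continuous[OF assms(2)]]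
      scott_continuous_comp[OF po tie_partial_order F_continuous[OF assms(1)] f_continuous])

lemma approximant_step:
  assumes d: "d \<in> F" and adm: "admissible D f d N M" and m: "m \<in> M"
    and x: "x \<in> carrier D" and dm: "d x \<sqsubseteq>\<^bsub>D\<^esub> m"
  shows "truncate N (f (d x)) \<sqsubseteq>\<^bsub>plotkin_tie\<^esub> truncate N (f m)"
proof -
  have "N \<ge> 1" "m \<in> carrier D" using adm m by (auto simp: admissible_def separates_def)
  then show ?thesis
    using scott_continuous_mono[OF truncate_scott_continuous] f_mono dm x f_carrier F_carrier[OF d] by metis
qed

text \<open>The compact values \<open>truncate N (f m)\<close>, for \<open>m\<close> in the separating set, mediate between
  an approximant and \<open>f\<close>.\<close>

lemma truncate_separator_le:
  assumes adm: "admissible D f d N M" and m: "m \<in> M"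
  shows "truncate N (f m) \<sqsubseteq>\<^bsub>plotkin_tie\<^esub> f m" "truncate N (f m) \<noteq> Tie_top" "truncate N (f m) \<in> carrier plotkin_tie"
proof -
  have N: "N \<ge> 1" and mC: "m \<in> carrier D" and fm: "f m = Tie_top \<or> level (f m) < enat N"
    using adm m by (auto simp: admissible_def separates_def)
  show c: "truncate N (f m) \<in> carrier plotkin_tie" using truncate_carrier[OF N f_carrier[OF mC]] .
  show "truncate N (f m) \<noteq> Tie_top" by (auto simp: truncate_def)
  show "truncate N (f m) \<sqsubseteq>\<^bsub>plotkin_tie\<^esub> f m"
    using fm tie_le_top[OF c] po_refl[OF tie_partial_order f_carrier[OF mC]] by (auto simp: truncate_def)
qed

text \<open>The approximant is way below \<open>f\<close> since finitely many compact values decide: once a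
  member \<open>g\<close> of a directed set dominates \<open>truncate N (f m)\<close> at each separator \<open>m\<close>, the inequalities \<open>d x \<le> m \<le> x\<close> give
  \<open>truncate N (f (d x)) \<le> truncate N (f m) \<le> g m \<le> g x\<close>.\<close>

lemma approximant_way_below:
  assumes d: "d \<in> F" and adm: "admissible D f d N M"
  shows "way_below S (approximant D f d N) f"
  unfolding way_below_def
proof (intro conjI allI impI)
  have N: "N \<ge> 1" and M: "finite M" "M \<subseteq> carrier D"
    and s: "\<And>x. x \<in> carrier D \<Longrightarrow> \<exists>m\<in>M. d x \<sqsubseteq>\<^bsub>D\<^esub> m \<and> m \<sqsubseteq>\<^bsub>D\<^esub> x"
    using adm by (auto simp: admissible_def separates_def)
  show "approximant D f d N \<in> carrier S" using approximant_carrier[OF d N] .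
  show "f \<in> carrier S" by (rule f)
  fix G s assume "directed S G \<and> is_sup S s G \<and> f \<sqsubseteq>\<^bsub>S\<^esub> s"
  then have G: "directed S G" and sG: "is_sup S s G" and fs: "f \<sqsubseteq>\<^bsub>S\<^esub> s" by auto
  have GC: "g \<in> carrier S" if "g \<in> G" for g using directed_carrier[OF G] that by blast
  have sC: "s \<in> carrier S" by (rule is_sup_carrier[OF sG])
  have "\<exists>g\<in>G. \<forall>m\<in>M. truncate N (f m) \<sqsubseteq>\<^bsub>plotkin_tie\<^esub> g m"
  proof (rule directed_collect[OF scott_space_partial_order[OF tie_partial_order] G M(1)])
    fix m assume m: "m \<in> M"
    then have mC: "m \<in> carrier D" using M by blast
    have "truncate N (f m) \<sqsubseteq>\<^bsub>plotkin_tie\<^esub> s m"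
      using po_trans[OF tie_partial_order truncate_separator_le(1)[OF adm m]] fs mC
        truncate_separator_le(3)[OF adm m] f_carrier scott_space_apply[OF sC] by (auto simp: scott_space_le)
    then show "\<exists>g\<in>G. truncate N (f m) \<sqsubseteq>\<^bsub>plotkin_tie\<^esub> g m"
      using tie_compact[OF scott_space_eval_directed[OF G mC] scott_space_sup_eval[OF po tie_dcpo G sG mC]]
        truncate_separator_le[OF adm m] by blast
  next
    fix m g h assume "m \<in> M" "g \<in> G" "h \<in> G" "g \<sqsubseteq>\<^bsub>S\<^esub> h" "truncate N (f m) \<sqsubseteq>\<^bsub>plotkin_tie\<^esub> g m"
    moreover from this have "m \<in> carrier D" using M by blast
    ultimately show "truncate N (f m) \<sqsubseteq>\<^bsub>plotkin_tie\<^esub> h m"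
      using po_trans[OF tie_partial_order, of "truncate N (f m)" "g m" "h m"] truncate_separator_le(3)[OF adm]
        scott_space_apply[OF GC] by (auto simp: scott_space_le)
  qed
  then obtain g where g: "g \<in> G" "\<And>m. m \<in> M \<Longrightarrow> truncate N (f m) \<sqsubseteq>\<^bsub>plotkin_tie\<^esub> g m" by blast
  have "truncate N (f (d x)) \<sqsubseteq>\<^bsub>plotkin_tie\<^esub> g x" if x: "x \<in> carrier D" for x
  proof -
    obtain m where m: "m \<in> M" "d x \<sqsubseteq>\<^bsub>D\<^esub> m" "m \<sqsubseteq>\<^bsub>D\<^esub> x" using s[OF x] by blast
    have mC: "m \<in> carrier D" using m(1) M by blast
    have gC: "g \<in> carrier S" and gc: "scott_continuous D plotkin_tie g"
      using GC[OF g(1)] by (auto simp: scott_space_carrier)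
    have "truncate N (f (d x)) \<sqsubseteq>\<^bsub>plotkin_tie\<^esub> g m"
      using po_trans[OF tie_partial_order approximant_step[OF d adm m(1) x m(2)] g(2)[OF m(1)]]
        truncate_carrier[OF N fd_carrier[OF d x]] truncate_separator_le(3)[OF adm m(1)] scott_space_apply[OF gC mC]
      by blast
    then show ?thesis
      using po_trans[OF tie_partial_order _ scott_continuous_mono[OF gc mC x m(3)]]
        truncate_carrier[OF N fd_carrier[OF d x]] scott_space_apply[OF gC mC] scott_space_apply[OF gC x]
      by blast
  qed
  then show "\<exists>g\<in>G. approximant D f d N \<sqsubseteq>\<^bsub>S\<^esub> g"
    using g(1) by (auto simp: scott_space_le approximant_def)
qed

lemma compact_below_fd:
  assumes x: "x \<in> carrier D" and c: "c \<in> carrier plotkin_tie" "c \<noteq> Tie_top" "c \<sqsubseteq>\<^bsub>plotkin_tie\<^esub> f x"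
  shows "\<exists>d\<in>F. c \<sqsubseteq>\<^bsub>plotkin_tie\<^esub> f (d x)"
proof -
  have dd: "directed D ((\<lambda>d. d x) ` F)" by (rule scott_space_eval_directed[OF dir x])
  show ?thesis
    using tie_compact[OF scott_continuous_directed[OF f_continuous dd]
        scott_continuous_sup[OF f_continuous dd sup[OF x]] c] by blast
qed

text \<open>Two truncations at different bounds are in general incomparable: truncation at \<open>N\<close>
  sends \<open>b\<^sub>N\<close> to \<open>a\<^sub>N\<close>, and truncation at \<open>K > N\<close> fixes \<open>b\<^sub>N\<close>. The approximants become comparable when
  the larger map \<open>e\<close> is chosen so that \<open>f \<circ> e\<close> has already passed level \<open>N\<close> wherever truncation
  at \<open>N\<close> has an effect; it suffices to check this at the separators that \<open>f\<close> maps to \<open>\<top>\<close>.\<close>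

lemma approximant_le:
  assumes d: "d \<in> F" "e \<in> F" "d \<sqsubseteq>\<^bsub>scott_space D D\<^esub> e"
    and adm: "admissible D f d N M" and N: "N < K"
    and big: "\<And>m. m \<in> M \<Longrightarrow> f m = Tie_top \<Longrightarrow> enat N < level (f (e m))"
  shows "approximant D f d N \<sqsubseteq>\<^bsub>S\<^esub> approximant D f e K"
  unfolding scott_space_le
proof
  fix x assume x: "x \<in> carrier D"
  have N1: "N \<ge> 1" and "\<exists>m\<in>M. d x \<sqsubseteq>\<^bsub>D\<^esub> m \<and> m \<sqsubseteq>\<^bsub>D\<^esub> x"
    using adm x by (auto simp: admissible_def separates_def)
  then obtain m where m: "m \<in> M" "d x \<sqsubseteq>\<^bsub>D\<^esub> m" "m \<sqsubseteq>\<^bsub>D\<^esub> x" by blast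
  have mC: "m \<in> carrier D" and fm: "f m = Tie_top \<or> level (f m) < enat N"
    using adm m by (auto simp: admissible_def separates_def)
  have cC: "truncate N (f (d x)) \<in> carrier plotkin_tie" "truncate K (f (e x)) \<in> carrier plotkin_tie"
    using truncate_carrier[OF _ fd_carrier[OF d(1) x]] truncate_carrier[OF _ fd_carrier[OF d(2) x]] N N1
    by auto
  have de: "f (d x) \<sqsubseteq>\<^bsub>plotkin_tie\<^esub> f (e x)"
    using f_mono[OF F_carrier[OF d(1) x] F_carrier[OF d(2) x]] d(3) x by (auto simp: scott_space_le)
  have "truncate N (f (d x)) \<sqsubseteq>\<^bsub>plotkin_tie\<^esub> truncate K (f (e x))"
  proof (cases "level (f (d x)) < enat N")
    case True
    show ?thesis
    proof (cases "level (f (e x)) < enat K")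
      case True
      then show ?thesis using de \<open>level (f (d x)) < enat N\<close> by (simp add: truncate_def)
    next
      case False
      have "level (f (d x)) < enat K" using True N by (meson enat_ord_simps(2) less_trans)
      then have "level (truncate N (f (d x))) < level (truncate K (f (e x)))" using True False by (simp add: truncate_def)
      then show ?thesis using cC tie_le_iff by blast
    qed
  next
    case False
    have "level (f (d x)) \<le> level (f m)"
      using level_f_mono[OF F_carrier[OF d(1) x] mC m(2)] .
    then have "f m = Tie_top" using fm False by auto
    then have "enat N < level (f (e m))" using big m(1) by blast
    also have "\<dots> \<le> level (f (e x))"
      by (rule level_f_mono[OF F_carrier[OF d(2) mC] F_carrier[OF d(2) x]
            scott_continuous_mono[OF F_continuous[OF d(2)] mC x m(3)]])
    finally have "level (truncate N (f (d x))) < level (truncate K (f (e x)))"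
      using False N by (auto simp: level_truncate)
    then show ?thesis using cC tie_le_iff by blast
  qed
  then show "approximant D f d N x \<sqsubseteq>\<^bsub>plotkin_tie\<^esub> approximant D f e K x"
    using x by (simp add: approximant_def)
qed

text \<open>Finitely many separators with value \<open>\<top>\<close> can be handled by one member of the family, since at each of them
  \<open>f \<circ> d\<close> converges to \<open>\<top>\<close> and so passes every finite level.\<close>

lemma level_eventually:
  assumes M: "finite M" "M \<subseteq> carrier D"
  shows "\<exists>e\<in>F. \<forall>m\<in>{m \<in> M. f m = Tie_top}. enat N < level (f (e m))"
proof (rule directed_collect[OF scott_space_partial_order[OF po] dir])
  show "finite {m \<in> M. f m = Tie_top}" using M by simp
next
  fix m assume "m \<in> {m \<in> M. f m = Tie_top}"
  then have m: "m \<in> carrier D" "f m = Tie_top" using M by auto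
  have "Tie_elt La (Suc N) \<in> carrier plotkin_tie" by (simp add: tie_carrier)
  then obtain d where d: "d \<in> F" "Tie_elt La (Suc N) \<sqsubseteq>\<^bsub>plotkin_tie\<^esub> f (d m)"
    using compact_below_fd[OF m(1), of "Tie_elt La (Suc N)"] m(2) tie_le_top by auto
  then have "enat (Suc N) \<le> level (f (d m))"
    using level_mono[OF d(2)] fd_carrier[OF d(1) m(1)] by (simp add: tie_carrier)
  then show "\<exists>d\<in>F. enat N < level (f (d m))" using d(1) by (auto simp: Suc_ile_eq)
next
  fix m d e assume "m \<in> {m \<in> M. f m = Tie_top}" and de: "d \<in> F" "e \<in> F" "d \<sqsubseteq>\<^bsub>scott_space D D\<^esub> e"
    and lt: "enat N < level (f (d m))"
  then have m: "m \<in> carrier D" using M by auto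
  have "level (f (d m)) \<le> level (f (e m))"
    by (rule level_fd_mono[OF de m])
  then show "enat N < level (f (e m))" using lt by simp
qed

lemma approximants_directed: "directed S (approximants f)"
  unfolding directed_def
proof (intro conjI ballI)
  show "approximants f \<subseteq> carrier S"
    unfolding approximants_def using approximant_carrier by (auto simp: admissible_def)
  obtain d where "d \<in> F" using dir by (auto simp: directed_def)
  then show "approximants f \<noteq> {}" using admissible_exists[of d f 0] by (auto simp: approximants_def)
  fix g g' assume "g \<in> approximants f" "g' \<in> approximants f"
  then obtain d N M d' N' M' where
    g: "g = approximant D f d N" "d \<in> F" "admissible D f d N M" and
    g': "g' = approximant D f d' N'" "d' \<in> F" "admissible D f d' N' M'"
    unfolding approximants_def by blast
  have "finite (M \<union> M')" "M \<union> M' \<subseteq> carrier D"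
    using g g' by (auto simp: admissible_def separates_def)
  then obtain e0 where e0: "e0 \<in> F" "\<forall>m\<in>{m \<in> M \<union> M'. f m = Tie_top}. enat (max N N') < level (f (e0 m))"
    using level_eventually by blast
  obtain e where e: "e \<in> F" "\<forall>h\<in>{d, d', e0}. h \<sqsubseteq>\<^bsub>scott_space D D\<^esub> e"
    using directed_finite_bound[OF scott_space_partial_order[OF po] dir, of "{d, d', e0}"] g g' e0 by blast
  obtain K L where K: "admissible D f e K L" "max N N' < K" using admissible_exists[OF e(1)] by blast
  have big: "enat (max N N') < level (f (e m))" if "m \<in> M \<union> M'" "f m = Tie_top" for m
  proof -
    have m: "m \<in> carrier D" using that(1) \<open>M \<union> M' \<subseteq> carrier D\<close> by blast
    have "level (f (e0 m)) \<le> level (f (e m))"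
      using level_fd_mono[OF e0(1) e(1) _ m] e(2) by blast
    moreover have "enat (max N N') < level (f (e0 m))" using e0(2) that by blast
    ultimately show ?thesis by (rule less_le_trans[rotated])
  qed
  have "g \<sqsubseteq>\<^bsub>S\<^esub> approximant D f e K"
    unfolding g(1)
  proof (rule approximant_le[OF g(2) e(1) _ g(3)])
    show "enat N < level (f (e m))" if "m \<in> M" "f m = Tie_top" for m
      by (rule le_less_trans[OF _ big[of m]]) (use that in auto)
    show "d \<sqsubseteq>\<^bsub>scott_space D D\<^esub> e" "N < K" using e(2) K(2) by auto
  qed
  moreover have "g' \<sqsubseteq>\<^bsub>S\<^esub> approximant D f e K"
    unfolding g'(1)
  proof (rule approximant_le[OF g'(2) e(1) _ g'(3)])
    show "enat N' < level (f (e m))" if "m \<in> M'" "f m = Tie_top" for m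
      by (rule le_less_trans[OF _ big[of m]]) (use that in auto)
    show "d' \<sqsubseteq>\<^bsub>scott_space D D\<^esub> e" "N' < K" using e(2) K(2) by auto
  qed
  ultimately show "\<exists>h\<in>approximants f. g \<sqsubseteq>\<^bsub>S\<^esub> h \<and> g' \<sqsubseteq>\<^bsub>S\<^esub> h"
    using e(1) K(1) by (auto simp: approximants_def)
qed

text \<open>A compact value \<open>c \<le> f x\<close> is attained below some \<open>f (d x)\<close>, and truncation above the
  level of \<open>c\<close> preserves it.\<close>

lemma approximants_sup: "is_sup S f (approximants f)"
proof (rule is_supI[OF directed_carrier[OF approximants_directed] f])
  fix g assume "g \<in> approximants f"
  then show "g \<sqsubseteq>\<^bsub>S\<^esub> f"
    unfolding approximants_def
    using way_below_imp_le[OF scott_space_partial_order[OF tie_partial_order] approximant_way_below] by blast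
next
  fix u assume u: "u \<in> carrier S" "\<And>g. g \<in> approximants f \<Longrightarrow> g \<sqsubseteq>\<^bsub>S\<^esub> u"
  show "f \<sqsubseteq>\<^bsub>S\<^esub> u"
    unfolding scott_space_le
  proof
    fix x assume x: "x \<in> carrier D"
    show "f x \<sqsubseteq>\<^bsub>plotkin_tie\<^esub> u x"
    proof (rule tie_le_by_compacts[OF f_carrier[OF x] scott_space_apply[OF u(1) x]])
      fix c assume c: "c \<in> carrier plotkin_tie" "c \<noteq> Tie_top" "c \<sqsubseteq>\<^bsub>plotkin_tie\<^esub> f x"
      obtain d where d: "d \<in> F" "c \<sqsubseteq>\<^bsub>plotkin_tie\<^esub> f (d x)" using compact_below_fd[OF x c] by blast
      obtain k where k: "level c = enat k" using c(2) level_eq_top by (metis not_infinity_eq)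
      obtain N M where N: "admissible D f d N M" "k < N" using admissible_exists[OF d(1)] by blast
      have N1: "N \<ge> 1" using N(1) by (simp add: admissible_def)
      have "approximant D f d N \<sqsubseteq>\<^bsub>S\<^esub> u" using u(2) d(1) N(1) by (auto simp: approximants_def)
      then have le: "truncate N (f (d x)) \<sqsubseteq>\<^bsub>plotkin_tie\<^esub> u x"
        using x by (auto simp: scott_space_le approximant_def)
      have "truncate N c = c" using k N(2) by (simp add: truncate_def)
      then have "c \<sqsubseteq>\<^bsub>plotkin_tie\<^esub> truncate N (f (d x))"
        using scott_continuous_mono[OF truncate_scott_continuous[OF N1] c(1) fd_carrier[OF d(1) x] d(2)] by simp
      then show "c \<sqsubseteq>\<^bsub>plotkin_tie\<^esub> u x"
        using po_trans[OF tie_partial_order _ le] c(1) truncate_carrier[OF N1 fd_carrier[OF d(1) x]]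
          scott_space_apply[OF u(1) x] by blast
    qed
  qed
qed

end

theorem function_space_continuous: "continuous_dcpo (scott_space D plotkin_tie)"
proof (rule continuous_dcpoI[OF scott_space_dcpo[OF po tie_dcpo]])
  fix f assume f: "f \<in> carrier (scott_space D plotkin_tie)"
  have "\<forall>b\<in>approximants f. way_below (scott_space D plotkin_tie) b f"
    using approximant_way_below[OF f] unfolding approximants_def by blast
  then show "\<exists>B. directed (scott_space D plotkin_tie) B \<and> is_sup (scott_space D plotkin_tie) f B \<and>
      (\<forall>b\<in>B. way_below (scott_space D plotkin_tie) b f)"
    using approximants_directed[OF f] approximants_sup[OF f] by blast
qed

end

section \<open>Failure of the FS property\<close>

text \<open>Evaluating a self-map \<open>h\<close> of the function space on constant maps, at a fixed point \<open>x\<close> of \<open>D\<close>, gives a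
  map \<open>r h\<close> of the tie below the identity. Compactness of \<open>a\<^sub>1\<close> and \<open>b\<^sub>1\<close> yields a member \<open>h\<close> of the
  family such that \<open>r h\<close> fixes both, and the shape of the tie propagates this to all finite
  levels.\<close>

theorem function_space_not_FS:
  fixes D :: "('a, 'b) gorder_scheme"
  assumes po: "partial_order D" and ne: "carrier D \<noteq> {}"
  shows "\<not> FS_domain (scott_space D plotkin_tie)"
proof
  let ?T = plotkin_tie
  let ?S = "scott_space D plotkin_tie"
  assume "FS_domain ?S"
  then obtain F where "directed (scott_space ?S ?S) F" "\<forall>h\<in>F. finitely_separated ?S h"
    "\<forall>g\<in>carrier ?S. is_sup ?S g ((\<lambda>h. h g) ` F)"
    unfolding FS_domain_def by blast
  then have "fs_poset ?S F"
    by (intro fs_poset.intro scott_space_partial_order tie_partial_order) blast+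
  then interpret F: fs_poset ?S F .
  obtain x where x: "x \<in> carrier D" using ne by blast
  define k where "k c = (\<lambda>_\<in>carrier D. c)" for c :: tie
  have k: "k c \<in> carrier ?S" if "c \<in> carrier ?T" for c
    unfolding k_def by (intro scott_space_restrict scott_continuous_const po tie_partial_order that)
  have kx: "k c x = c" for c using x by (simp add: k_def)
  have kmono: "k c \<sqsubseteq>\<^bsub>?S\<^esub> k c'" if "c \<sqsubseteq>\<^bsub>?T\<^esub> c'" for c c'
    using that by (simp add: scott_space_le k_def)
  define r where "r h c = h (k c) x" for h :: "('a \<Rightarrow> tie) \<Rightarrow> 'a \<Rightarrow> tie" and c
  have rC: "r h c \<in> carrier ?T" if "h \<in> F" "c \<in> carrier ?T" for h c
    unfolding r_def using scott_space_apply[OF F.F_carrier[OF that(1) k[OF that(2)]] x] .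
  have rle: "r h c \<sqsubseteq>\<^bsub>?T\<^esub> c" if "h \<in> F" "c \<in> carrier ?T" for h c
    using F.F_le_id[OF that(1) k[OF that(2)]] x kx by (auto simp: scott_space_le r_def)
  have rmono: "r h c \<sqsubseteq>\<^bsub>?T\<^esub> r h c'" if "h \<in> F" "c \<in> carrier ?T" "c' \<in> carrier ?T" "c \<sqsubseteq>\<^bsub>?T\<^esub> c'" for h c c'
    using scott_continuous_mono[OF F.F_continuous[OF that(1)] k[OF that(2)] k[OF that(3)] kmono[OF that(4)]] x
    by (auto simp: scott_space_le r_def)
  have atom: "\<exists>h\<in>F. Tie_elt u 1 \<sqsubseteq>\<^bsub>?T\<^esub> r h (Tie_elt u 1)" for u
  proof -
    have c: "Tie_elt u 1 \<in> carrier ?T" by (simp add: tie_carrier)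
    have dirS: "directed ?S ((\<lambda>h. h (k (Tie_elt u 1))) ` F)"
      by (rule scott_space_eval_directed[OF F.dir k[OF c]])
    have "is_sup ?T (k (Tie_elt u 1) x) ((\<lambda>g. g x) ` (\<lambda>h. h (k (Tie_elt u 1))) ` F)"
      by (rule scott_space_sup_eval[OF po tie_dcpo dirS F.sup[OF k[OF c]] x])
    then show ?thesis
      using tie_compact[OF scott_space_eval_directed[OF dirS x], of "k (Tie_elt u 1) x" "Tie_elt u 1"] c
        po_refl[OF tie_partial_order c] by (auto simp: kx r_def)
  qed
  have "\<exists>h\<in>F. \<forall>u\<in>{La, Lb}. Tie_elt u 1 \<sqsubseteq>\<^bsub>?T\<^esub> r h (Tie_elt u 1)"
  proof (rule directed_collect[OF scott_space_partial_order[OF F.po] F.dir])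
    fix u h h'
    assume h: "h \<in> F" "h' \<in> F" "h \<sqsubseteq>\<^bsub>scott_space ?S ?S\<^esub> h'" "Tie_elt u 1 \<sqsubseteq>\<^bsub>?T\<^esub> r h (Tie_elt u 1)"
    have c: "Tie_elt u 1 \<in> carrier ?T" by (simp add: tie_carrier)
    have "r h (Tie_elt u 1) \<sqsubseteq>\<^bsub>?T\<^esub> r h' (Tie_elt u 1)"
      using h(3) k[OF c] x by (auto simp: scott_space_le r_def)
    then show "Tie_elt u 1 \<sqsubseteq>\<^bsub>?T\<^esub> r h' (Tie_elt u 1)"
      using po_trans[OF tie_partial_order h(4) _ c rC[OF h(1) c] rC[OF h(2) c]] by blast
  qed (use atom in auto)
  then obtain h where h: "h \<in> F" and "\<forall>u\<in>{La, Lb}. Tie_elt u 1 \<sqsubseteq>\<^bsub>?T\<^esub> r h (Tie_elt u 1)" by blast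
  then have h1: "Tie_elt u 1 \<sqsubseteq>\<^bsub>?T\<^esub> r h (Tie_elt u 1)" for u by (cases u) auto
  have fix_elt: "r h (Tie_elt u (Suc n)) = Tie_elt u (Suc n)" for u n
  proof (induction n arbitrary: u)
    case 0
    then show ?case
      using po_antisym[OF tie_partial_order rle[OF h] h1 rC[OF h]] by (simp add: tie_carrier)
  next
    case (Suc n)
    let ?c = "Tie_elt u (Suc (Suc n))"
    have c: "?c \<in> carrier ?T" by (simp add: tie_carrier)
    have below: "Tie_elt v (Suc n) \<sqsubseteq>\<^bsub>?T\<^esub> r h ?c" for v
      using rmono[OF h, of "Tie_elt v (Suc n)" ?c] Suc[of v] by (simp add: tie_carrier tie_le_iff)
    \<comment> \<open>\<open>r h ?c\<close> is above both elements of level \<open>n + 1\<close>, hence equal to neither.\<close>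
    have "enat (Suc n) < level (r h ?c)"
      using below[of La] below[of Lb] rC[OF h c]
      by (cases "r h ?c") (auto simp: tie_le_iff tie_carrier)
    then have "\<not> level (r h ?c) < level ?c" by (cases "level (r h ?c)") auto
    then show ?case using rle[OF h c] rC[OF h c] c by (auto simp: tie_le_iff)
  qed
  obtain M where M: "finite M" "M \<subseteq> carrier ?S"
    "\<And>g. g \<in> carrier ?S \<Longrightarrow> \<exists>m\<in>M. h g \<sqsubseteq>\<^bsub>?S\<^esub> m \<and> m \<sqsubseteq>\<^bsub>?S\<^esub> g"
    using F.sep[OF h] unfolding finitely_separated_def by blast
  have "Tie_elt La (Suc n) \<in> (\<lambda>m. m x) ` M" for n
  proof -
    let ?c = "Tie_elt La (Suc n)"
    have c: "?c \<in> carrier ?T" by (simp add: tie_carrier)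
    obtain m where m: "m \<in> M" "h (k ?c) \<sqsubseteq>\<^bsub>?S\<^esub> m" "m \<sqsubseteq>\<^bsub>?S\<^esub> k ?c" using M(3)[OF k[OF c]] by blast
    have "?c \<sqsubseteq>\<^bsub>?T\<^esub> m x" "m x \<sqsubseteq>\<^bsub>?T\<^esub> ?c"
      using m x fix_elt[of La n] kx by (auto simp: scott_space_le r_def)
    then have "m x = ?c"
      using po_antisym[OF tie_partial_order _ _ scott_space_apply[of m, OF _ x] c] m(1) M(2) by blast
    then show ?thesis using m(1) by (metis imageI)
  qed
  then have "range (\<lambda>n. Tie_elt La (Suc n)) \<subseteq> (\<lambda>m. m x) ` M" by blast
  then have "finite (range (\<lambda>n. Tie_elt La (Suc n)))" using M(1) finite_subset by blast
  moreover have "inj (\<lambda>n. Tie_elt La (Suc n))" by (auto simp: inj_def)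
  ultimately show False using finite_imageD infinite_UNIV_nat by blast
qed

section \<open>Adjoining a greatest element\<close>

lemma adjoin_top_carrier [simp]:
  "top.Value x \<in> carrier (adjoin_top D) \<longleftrightarrow> x \<in> carrier D" "top.Top \<in> carrier (adjoin_top D)"
  by (auto simp: adjoin_top_def)

lemma adjoin_top_le [simp]:
  "top.Value x \<sqsubseteq>\<^bsub>adjoin_top D\<^esub> top.Value y \<longleftrightarrow> x \<sqsubseteq>\<^bsub>D\<^esub> y"
  "z \<sqsubseteq>\<^bsub>adjoin_top D\<^esub> top.Top"
  "\<not> top.Top \<sqsubseteq>\<^bsub>adjoin_top D\<^esub> top.Value y"
  by (auto simp: adjoin_top_def)

lemma adjoin_top_partial_order:
  assumes D: "partial_order D"
  shows "partial_order (adjoin_top D)"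
proof (rule partial_orderI)
  show "eq (adjoin_top D) = (=)" by (simp add: adjoin_top_def)
next
  fix x assume "x \<in> carrier (adjoin_top D)"
  then show "x \<sqsubseteq>\<^bsub>adjoin_top D\<^esub> x" using po_refl[OF D] by (cases x) auto
next
  fix x y
  assume "x \<in> carrier (adjoin_top D)" "y \<in> carrier (adjoin_top D)"
    "x \<sqsubseteq>\<^bsub>adjoin_top D\<^esub> y" "y \<sqsubseteq>\<^bsub>adjoin_top D\<^esub> x"
  then show "x = y" using po_antisym[OF D] by (cases x; cases y) auto
next
  fix x y z
  assume "x \<in> carrier (adjoin_top D)" "y \<in> carrier (adjoin_top D)" "z \<in> carrier (adjoin_top D)"
    "x \<sqsubseteq>\<^bsub>adjoin_top D\<^esub> y" "y \<sqsubseteq>\<^bsub>adjoin_top D\<^esub> z"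
  then show "x \<sqsubseteq>\<^bsub>adjoin_top D\<^esub> z"
    by (cases x; cases y; cases z; simp; blast intro: po_trans[OF D])
qed

lemma adjoin_top_sup_Value:
  assumes A: "A \<subseteq> carrier D" and s: "is_sup D s A"
  shows "is_sup (adjoin_top D) (top.Value s) (top.Value ` A)"
proof (rule is_supI)
  fix u assume u: "u \<in> carrier (adjoin_top D)"
    "\<And>x. x \<in> top.Value ` A \<Longrightarrow> x \<sqsubseteq>\<^bsub>adjoin_top D\<^esub> u"
  show "top.Value s \<sqsubseteq>\<^bsub>adjoin_top D\<^esub> u"
  proof (cases u)
    case (Value v)
    have "s \<sqsubseteq>\<^bsub>D\<^esub> v"
      by (rule is_sup_least[OF s A]) (use u(1) u(2)[OF imageI] Value in simp_all)
    then show ?thesis using Value by simp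
  qed simp
qed (use A s is_sup_carrier[OF s] is_sup_upper[OF s A] in auto)

lemma adjoin_top_directed_cases:
  assumes A: "directed (adjoin_top D) A"
  obtains (top) "top.Top \<in> A" | (below) A' where "A = top.Value ` A'" "directed D A'"
proof (cases "top.Top \<in> A")
  case False
  define A' where "A' = top.Value -` A"
  have eq: "A = top.Value ` A'"
  proof -
    have "x \<in> top.Value ` A'" if "x \<in> A" for x
      using that False by (cases x) (auto simp: A'_def)
    then show ?thesis by (auto simp: A'_def)
  qed
  have "directed D A'"
    unfolding directed_def
  proof (intro conjI ballI)
    show "A' \<subseteq> carrier D" using directed_carrier[OF A] eq by auto
    show "A' \<noteq> {}" using A eq by (auto simp: directed_def)
    fix x y assume "x \<in> A'" "y \<in> A'"
    then have "\<exists>z\<in>A. top.Value x \<sqsubseteq>\<^bsub>adjoin_top D\<^esub> z \<and> top.Value y \<sqsubseteq>\<^bsub>adjoin_top D\<^esub> z"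
      by (intro directed_bound[OF A]) (simp_all add: eq)
    then show "\<exists>z\<in>A'. x \<sqsubseteq>\<^bsub>D\<^esub> z \<and> y \<sqsubseteq>\<^bsub>D\<^esub> z" by (simp add: eq)
  qed
  then show ?thesis using eq below by blast
qed (rule top)

fun lift_top :: "('a \<Rightarrow> 'b) \<Rightarrow> 'a top \<Rightarrow> 'b top" where
  "lift_top f (top.Value x) = top.Value (f x)"
| "lift_top f top.Top = top.Top"

text \<open>That \<open>D\<close> is a dcpo matters: otherwise a directed set without supremum in \<open>D\<close>
  could acquire the new top as its supremum, while its image under \<open>f\<close> has a supremum in \<open>E\<close>.\<close>

lemma lift_top_scott_continuous:
  assumes D: "dcpo D" and E: "partial_order E" and f: "scott_continuous D E f"
  shows "scott_continuous (adjoin_top D) (adjoin_top E) (lift_top f)"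
proof -
  have po: "partial_order D" using D by (simp add: dcpo_def)
  have carr: "lift_top f x \<in> carrier (adjoin_top E)" if "x \<in> carrier (adjoin_top D)" for x
    using that scott_continuous_carrier[OF f] by (cases x) auto
  have mono: "lift_top f x \<sqsubseteq>\<^bsub>adjoin_top E\<^esub> lift_top f y"
    if "x \<in> carrier (adjoin_top D)" "y \<in> carrier (adjoin_top D)" "x \<sqsubseteq>\<^bsub>adjoin_top D\<^esub> y" for x y
    using that scott_continuous_mono[OF f] by (cases x; cases y) auto
  show ?thesis
  proof (rule scott_continuousI[OF adjoin_top_partial_order[OF po] adjoin_top_partial_order[OF E] carr mono])
    fix A s assume A: "directed (adjoin_top D) A" and s: "is_sup (adjoin_top D) s A"
    have AC: "A \<subseteq> carrier (adjoin_top D)" by (rule directed_carrier[OF A])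
    show "is_sup (adjoin_top E) (lift_top f s) (lift_top f ` A)"
      using A
    proof (cases rule: adjoin_top_directed_cases)
      case top
      then have "is_sup (adjoin_top D) top.Top A" by (intro is_sup_greatest AC) auto
      then have "s = top.Top" using is_sup_unique[OF adjoin_top_partial_order[OF po] s] by blast
      moreover have "top.Top \<in> lift_top f ` A" using top by (metis imageI lift_top.simps(2))
      ultimately show ?thesis using carr AC by (auto intro!: is_sup_greatest)
    next
      case (below A')
      then obtain s' where s': "is_sup D s' A'" using D by (auto simp: dcpo_def)
      have A': "A' \<subseteq> carrier D" by (rule directed_carrier[OF below(2)])
      have "s = top.Value s'"
        using is_sup_unique[OF adjoin_top_partial_order[OF po] s] adjoin_top_sup_Value[OF A' s'] below(1)
        by blast
      moreover have "lift_top f ` A = top.Value ` f ` A'" by (simp add: below(1) image_image)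
      moreover have "is_sup (adjoin_top E) (top.Value (f s')) (top.Value ` f ` A')"
        using scott_continuous_sup[OF f below(2) s'] A' scott_continuous_carrier[OF f]
        by (intro adjoin_top_sup_Value) auto
      ultimately show ?thesis by simp
    qed
  qed
qed

lemma fs_poset_adjoin_top:
  fixes D :: "('a, 'b) gorder_scheme"
  assumes D: "dcpo D" and F: "fs_poset D F"
  shows "fs_poset (adjoin_top D) ((\<lambda>d. restrict (lift_top d) (carrier (adjoin_top D))) ` F)"
    (is "fs_poset ?D (?l ` F)")
proof -
  interpret fs_poset D F by (rule F)
  show ?thesis
  proof (rule fs_poset.intro)
    show "partial_order ?D" by (rule adjoin_top_partial_order[OF po])
    show "directed (scott_space ?D ?D) (?l ` F)"
    proof (rule directed_image[OF dir])
      fix d assume "d \<in> F"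
      then show "?l d \<in> carrier (scott_space ?D ?D)"
        by (intro scott_space_restrict lift_top_scott_continuous D po F_continuous)
    next
      fix d e assume de: "d \<sqsubseteq>\<^bsub>scott_space D D\<^esub> e"
      show "?l d \<sqsubseteq>\<^bsub>scott_space ?D ?D\<^esub> ?l e"
        unfolding scott_space_le
      proof
        fix x assume "x \<in> carrier ?D"
        then show "?l d x \<sqsubseteq>\<^bsub>?D\<^esub> ?l e x" using de by (cases x) (auto simp: scott_space_le)
      qed
    qed
  next
    fix h assume "h \<in> ?l ` F"
    then obtain d where d: "d \<in> F" "h = ?l d" by blast
    obtain M where M: "finite M" "M \<subseteq> carrier D"
      "\<And>x. x \<in> carrier D \<Longrightarrow> \<exists>m\<in>M. d x \<sqsubseteq>\<^bsub>D\<^esub> m \<and> m \<sqsubseteq>\<^bsub>D\<^esub> x"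
      using sep[OF d(1)] unfolding finitely_separated_def by blast
    show "finitely_separated ?D h"
      unfolding finitely_separated_def
    proof (intro exI conjI ballI)
      show "finite (insert top.Top (top.Value ` M))" using M by simp
      show "insert top.Top (top.Value ` M) \<subseteq> carrier ?D" using M by auto
      fix x assume "x \<in> carrier ?D"
      then show "\<exists>m\<in>insert top.Top (top.Value ` M). h x \<sqsubseteq>\<^bsub>?D\<^esub> m \<and> m \<sqsubseteq>\<^bsub>?D\<^esub> x"
        using M(3) d(2) by (cases x) auto
    qed
  next
    fix x assume x: "x \<in> carrier ?D"
    have ne: "F \<noteq> {}" using dir by (simp add: directed_def)
    show "is_sup ?D x ((\<lambda>h. h x) ` ?l ` F)"
    proof (cases x)
      case (Value y)
      then have y: "y \<in> carrier D" using x by simp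
      have "(\<lambda>h. h x) ` ?l ` F = top.Value ` (\<lambda>d. d y) ` F"
        by (simp add: image_image Value y)
      moreover have "is_sup ?D (top.Value y) (top.Value ` (\<lambda>d. d y) ` F)"
        using ne F_carrier y by (intro adjoin_top_sup_Value sup) auto
      ultimately show ?thesis using Value by simp
    next
      case Top
      then have "(\<lambda>h. h x) ` ?l ` F = {top.Top}" using ne by (simp add: image_image image_constant_conv)
      then show ?thesis using Top by (auto intro!: is_sup_greatest)
    qed
  qed
qed

section \<open>The closed-disk domain\<close>

lemma Disk_simps [simp]:
  "X \<in> carrier Disk \<longleftrightarrow> X = UNIV \<or> (\<exists>z r. r \<ge> 0 \<and> X = cball z r)"
  "X \<sqsubseteq>\<^bsub>Disk\<^esub> Y \<longleftrightarrow> Y \<subseteq> X"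
  "eq Disk = (=)"
  by (auto simp: Disk_def)

lemma Disk_partial_order: "partial_order Disk"
  by (rule partial_orderI) auto

lemma UNIV_not_subset_cball: "\<not> (UNIV :: (real ^ 2) set) \<subseteq> cball z r"
  by (metis bounded_cball bounded_subset not_bounded_UNIV)

text \<open>The limit disk of a filtered family. Inclusion \<open>cball w s \<subseteq> cball w' s'\<close> means
  \<open>dist w w' + s \<le> s'\<close> and depends on the radii only through their difference. Hence with \<open>r\<close> the infimum of the radii, the
  concentric disks of radius \<open>s - r\<close> are still filtered, and by compactness they have a common
  point \<open>z\<close>, the centre of the limit. The last conclusion says that the members below any given one
  converge to it in centre and radius.\<close>

lemma Disk_directed_Inter:
  assumes A: "directed Disk A" and nU: "\<exists>X\<in>A. X \<noteq> UNIV"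
  obtains z r where "r \<ge> 0" "\<Inter>A = cball z r"
    "\<And>e K. e > 0 \<Longrightarrow> K \<in> A \<Longrightarrow> \<exists>w s. cball w s \<in> A \<and> cball w s \<subseteq> K \<and> s \<ge> 0 \<and> s < r + e \<and> dist z w \<le> s - r"
proof -
  have AC: "X = UNIV \<or> (\<exists>z r. r \<ge> 0 \<and> X = cball z r)" if "X \<in> A" for X
    using subsetD[OF directed_carrier[OF A] that] by simp
  define R where "R = {s. s \<ge> 0 \<and> (\<exists>w. cball w s \<in> A)}"
  define r where "r = Inf R"
  have Rne: "R \<noteq> {}" using nU AC unfolding R_def by blast
  have Rbdd: "bdd_below R" unfolding R_def by (rule bdd_belowI[of _ 0]) auto
  have r0: "r \<ge> 0" unfolding r_def by (rule cInf_greatest[OF Rne]) (simp add: R_def)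
  have rle: "r \<le> s" if "cball w s \<in> A" "s \<ge> 0" for w s
    unfolding r_def by (rule cInf_lower[OF _ Rbdd]) (use that in \<open>auto simp: R_def\<close>)
  have below: "\<exists>w s. L = cball w s \<and> s \<ge> 0 \<and> dist w w' + s \<le> s'"
    if L: "L \<in> A" "L \<subseteq> cball w' s'" for L w' s'
  proof -
    have "L \<noteq> UNIV" using L(2) UNIV_not_subset_cball by metis
    then obtain w s where "s \<ge> 0" "L = cball w s" using AC[OF L(1)] by blast
    then show ?thesis using L(2) cball_subset_cball_iff[of w s w' s'] by auto
  qed
  define C where "C = {cball w (s - r) |w s. cball w s \<in> A \<and> s \<ge> 0}"
  have "\<Inter>C \<noteq> {}"
  proof (rule compact_fip_Heine_Borel)
    show "compact T" if "T \<in> C" for T using that by (auto simp: C_def)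
    fix C' assume C': "finite C'" "C' \<subseteq> C"
    show "\<Inter>C' \<noteq> {}"
    proof (cases "C' = {}")
      case False
      have "\<exists>K\<in>A. \<forall>T\<in>C'. \<exists>w s. K = cball w s \<and> s \<ge> 0 \<and> cball w (s - r) \<subseteq> T"
      proof (rule directed_collect[OF Disk_partial_order A C'(1)])
        show "\<exists>K\<in>A. \<exists>w s. K = cball w s \<and> s \<ge> 0 \<and> cball w (s - r) \<subseteq> T" if "T \<in> C'" for T
          using that C'(2) unfolding C_def by blast
      next
        fix T K L assume "K \<in> A" and L: "L \<in> A" and le: "K \<sqsubseteq>\<^bsub>Disk\<^esub> L"
          and "\<exists>w s. K = cball w s \<and> s \<ge> 0 \<and> cball w (s - r) \<subseteq> T"
        then obtain w' s' where K: "K = cball w' s'" "s' \<ge> 0" "cball w' (s' - r) \<subseteq> T" by blast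
        obtain w s where ws: "L = cball w s" "s \<ge> 0" "dist w w' + s \<le> s'"
          using below[OF L, of w' s'] le K(1) by (auto simp only: Disk_simps)
        have "cball w (s - r) \<subseteq> cball w' (s' - r)" using ws(3) by (simp add: cball_subset_cball_iff)
        then show "\<exists>w s. L = cball w s \<and> s \<ge> 0 \<and> cball w (s - r) \<subseteq> T" using ws K(3) by blast
      qed
      then obtain K where K: "K \<in> A" "\<And>T. T \<in> C' \<Longrightarrow> \<exists>w s. K = cball w s \<and> s \<ge> 0 \<and> cball w (s - r) \<subseteq> T"
        by blast
      obtain w s where ws: "K = cball w s" "s \<ge> 0" using K(2) False by blast
      have "w \<in> T" if T: "T \<in> C'" for T
      proof -
        obtain w' s' where "K = cball w' s'" "s' \<ge> 0" "cball w' (s' - r) \<subseteq> T" using K(2)[OF T] by blast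
        moreover from this have "w' = w" "s' = s" using ws by (auto simp: cball_eq_cball_iff)
        moreover have "w \<in> cball w (s - r)" using rle[of w s] K(1) ws by simp
        ultimately show ?thesis by blast
      qed
      then show ?thesis by blast
    qed simp
  qed
  then obtain z where "z \<in> \<Inter>C" by blast
  then have z: "dist z w \<le> s - r" if "cball w s \<in> A" "s \<ge> 0" for w s
    using that unfolding C_def by (force simp: dist_commute)
  have approx: "\<exists>w s. cball w s \<in> A \<and> cball w s \<subseteq> K \<and> s \<ge> 0 \<and> s < r + e \<and> dist z w \<le> s - r"
    if e: "e > 0" and K: "K \<in> A" for e K
  proof -
    obtain s' where "s' \<in> R" "s' < r + e"
      using cInf_lessD[OF Rne, of "r + e"] e by (auto simp: r_def)
    then obtain w' where s': "cball w' s' \<in> A" "s' \<ge> 0" "s' < r + e" by (auto simp: R_def)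
    obtain L where L: "L \<in> A" "L \<subseteq> K" "L \<subseteq> cball w' s'"
      using directed_bound[OF A K s'(1)] by auto
    obtain w s where ws: "L = cball w s" "s \<ge> 0" "dist w w' + s \<le> s'" using below[OF L(1,3)] by blast
    have "s < r + e" using ws(3) s'(3) zero_le_dist[of w w'] by linarith
    then show ?thesis using L ws z by blast
  qed
  have "\<Inter>A = cball z r"
  proof
    show "cball z r \<subseteq> \<Inter>A"
    proof
      fix x assume x: "x \<in> cball z r"
      have "x \<in> K" if K: "K \<in> A" for K
        using AC[OF K]
      proof
        assume "\<exists>w s. s \<ge> 0 \<and> K = cball w s"
        then obtain w s where ws: "s \<ge> 0" "K = cball w s" by blast
        have "dist w x \<le> dist w z + dist z x" by (rule dist_triangle)
        also have "\<dots> \<le> s" using z[of w s] x ws K by (simp add: dist_commute)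
        finally show ?thesis using ws by simp
      qed simp
      then show "x \<in> \<Inter>A" by blast
    qed
    show "\<Inter>A \<subseteq> cball z r"
    proof
      fix x assume x: "x \<in> \<Inter>A"
      have "dist z x \<le> r + e" if e: "e > 0" for e
      proof -
        obtain K where "K \<in> A" using nU by blast
        then obtain w s where ws: "cball w s \<in> A" "s < r + e / 2" "dist z w \<le> s - r"
          using approx[of "e / 2" K] e by auto
        have "dist w x \<le> s" using x ws(1) by (auto simp: mem_cball)
        then show ?thesis using dist_triangle[of z x w] ws by linarith
      qed
      then show "x \<in> cball z r" by (simp add: field_le_epsilon)
    qed
  qed
  then show ?thesis using that r0 approx by blast
qed

lemma Disk_sup_Inter:
  assumes A: "directed Disk A"
  shows "is_sup Disk (\<Inter>A) A"
proof (rule is_supI[OF directed_carrier[OF A]])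
  show "\<Inter>A \<in> carrier Disk"
  proof (cases "\<exists>X\<in>A. X \<noteq> UNIV")
    case True
    then show ?thesis using Disk_directed_Inter[OF A] by (metis Disk_simps(1))
  qed auto
qed auto

lemma Disk_dcpo: "dcpo Disk"
  unfolding dcpo_def using Disk_partial_order Disk_sup_Inter by blast

text \<open>On disks inside the open ball this is enlargement of the radius (see \<open>thicken_cball\<close>); writing it
  as a union of balls makes monotonicity evident without reference to centres and radii. The cutoff
  leaves only a bounded set of disks to be separated.\<close>

definition thicken :: "nat \<Rightarrow> (real ^ 2) set \<Rightarrow> (real ^ 2) set" where
  "thicken n X = (if X \<subseteq> ball 0 (real n) then \<Union>x\<in>X. cball x (1 / (real n + 1)) else UNIV)"

lemma Union_cball_cball:
  fixes z :: "'a :: euclidean_space"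
  assumes r: "r \<ge> 0" and e: "e \<ge> 0"
  shows "(\<Union>x\<in>cball z r. cball x e) = cball z (r + e)"
proof
  show "(\<Union>x\<in>cball z r. cball x e) \<subseteq> cball z (r + e)"
  proof
    fix y assume "y \<in> (\<Union>x\<in>cball z r. cball x e)"
    then obtain x where "dist z x \<le> r" "dist x y \<le> e" by auto
    then show "y \<in> cball z (r + e)" using dist_triangle[of z y x] by simp
  qed
  show "cball z (r + e) \<subseteq> (\<Union>x\<in>cball z r. cball x e)"
  proof
    fix y assume y: "y \<in> cball z (r + e)"
    show "y \<in> (\<Union>x\<in>cball z r. cball x e)"
    proof (cases "dist z y \<le> r")
      case True
      then show ?thesis using e by (auto intro!: bexI[of _ y])
    next
      case False
      define x where "x = z + (r / norm (y - z)) *\<^sub>R (y - z)"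
      have n: "norm (y - z) > r" "norm (y - z) > 0" using False r by (auto simp: dist_norm norm_minus_commute)
      have "dist z x = r" using n r by (simp add: x_def dist_norm)
      have "y - x = (1 - r / norm (y - z)) *\<^sub>R (y - z)" by (simp add: x_def algebra_simps)
      then have "norm (y - x) = (1 - r / norm (y - z)) * norm (y - z)" using n by simp
      also have "\<dots> = norm (y - z) - r" using n by (simp add: field_simps)
      also have "\<dots> \<le> e" using y by (simp add: dist_norm norm_minus_commute)
      finally show ?thesis
        using \<open>dist z x = r\<close> by (auto intro!: bexI[of _ x] simp: dist_norm norm_minus_commute)
    qed
  qed
qed

lemma thicken_cball:
  assumes "r \<ge> 0" "cball z r \<subseteq> ball 0 (real n)"
  shows "thicken n (cball z r) = cball z (r + 1 / (real n + 1))"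
  using assms Union_cball_cball[of r "1 / (real n + 1)" z] by (simp add: thicken_def)

lemma cball_subset_ball_0:
  assumes "r \<ge> 0"
  shows "cball (z :: real ^ 2) r \<subseteq> ball 0 (real n) \<longleftrightarrow> norm z + r < real n"
  using assms by (simp add: cball_subset_ball_iff)

lemma thicken_carrier: "X \<in> carrier Disk \<Longrightarrow> thicken n X \<in> carrier Disk"
proof (cases "X \<subseteq> ball 0 (real n)")
  case True
  assume "X \<in> carrier Disk"
  then obtain z r where "r \<ge> 0" "X = cball z r"
    using True by (metis Disk_simps(1) UNIV_not_subset_cball ball_subset_cball order_trans)
  then have "thicken n X = cball z (r + 1 / (real n + 1))" "r + 1 / (real n + 1) \<ge> 0"
    using thicken_cball True by auto
  then show ?thesis by (metis Disk_simps(1))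
qed (simp add: thicken_def)

lemma thicken_mono: "X \<subseteq> Y \<Longrightarrow> thicken n X \<subseteq> thicken n Y"
  by (auto simp: thicken_def)

lemma thicken_antimono:
  assumes "m \<le> n"
  shows "thicken n X \<subseteq> thicken m X"
proof (cases "X \<subseteq> ball 0 (real m)")
  case True
  then have "X \<subseteq> ball 0 (real n)" using assms by (meson subset_ball of_nat_mono order_trans)
  moreover have "cball x (1 / (real n + 1)) \<subseteq> cball x (1 / (real m + 1))" for x :: "real ^ 2"
    using assms by (intro subset_cball frac_le) auto
  ultimately show ?thesis using True by (auto simp: thicken_def)
qed (simp add: thicken_def)

lemma subset_thicken: "X \<subseteq> thicken n X"
  by (auto simp: thicken_def intro!: bexI)

text \<open>If the limit disk lies in the open ball, compactness puts some member of the
  family inside it as well; below that member the enlarged disks converge to the enlarged limit. If it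
  does not, every member is sent to the whole plane.\<close>

lemma thicken_scott_continuous: "scott_continuous Disk Disk (thicken n)"
proof (rule scott_continuousI[OF Disk_partial_order Disk_partial_order thicken_carrier])
  fix A X assume A: "directed Disk A" and X: "is_sup Disk X A"
  have X_eq: "X = \<Inter>A" using is_sup_unique[OF Disk_partial_order X Disk_sup_Inter[OF A]] .
  let ?e = "1 / (real n + 1)"
  show "is_sup Disk (thicken n X) (thicken n ` A)"
  proof (rule is_supI)
    show "thicken n ` A \<subseteq> carrier Disk" using thicken_carrier directed_carrier[OF A] by blast
    show "thicken n X \<in> carrier Disk" using thicken_carrier is_sup_carrier[OF X] by blast
    show "Y \<sqsubseteq>\<^bsub>Disk\<^esub> thicken n X" if "Y \<in> thicken n ` A" for Y
      using that thicken_mono[OF Inter_lower[of _ A]] by (auto simp only: X_eq Disk_simps)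
  next
    fix U assume "\<And>Y. Y \<in> thicken n ` A \<Longrightarrow> Y \<sqsubseteq>\<^bsub>Disk\<^esub> U"
    then have U: "U \<subseteq> thicken n K" if "K \<in> A" for K using that by auto
    have "U \<subseteq> thicken n X"
    proof (cases "X \<subseteq> ball 0 (real n)")
      case True
      then have "X \<noteq> UNIV" by (metis UNIV_not_subset_cball ball_subset_cball order_trans)
      then have "\<exists>X\<in>A. X \<noteq> UNIV" by (auto simp: X_eq)
      then obtain z r where r: "r \<ge> 0" "\<Inter>A = cball z r" and
        approx: "\<And>e K. e > 0 \<Longrightarrow> K \<in> A \<Longrightarrow>
          \<exists>w s. cball w s \<in> A \<and> cball w s \<subseteq> K \<and> s \<ge> 0 \<and> s < r + e \<and> dist z w \<le> s - r"
        using Disk_directed_Inter[OF A] by metis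
      have zr: "norm z + r < real n" using True r X_eq cball_subset_ball_0 by metis
      obtain K0 where "K0 \<in> A" using A by (auto simp: directed_def)
      \<comment> \<open>Half of the gap to the boundary is left for the error of the radius, half for that of the centre.\<close>
      moreover have "(real n - norm z - r) / 2 > 0" using zr by simp
      ultimately obtain w0 s0 where K: "cball w0 s0 \<in> A" "s0 \<ge> 0"
        "s0 < r + (real n - norm z - r) / 2" "dist z w0 \<le> s0 - r"
        using approx by blast
      have "norm w0 \<le> norm z + dist z w0" using norm_triangle_ineq2[of w0 z] by (simp add: dist_norm norm_minus_commute)
      then have "norm w0 + s0 < real n" using K(3,4) by argo
      then have Kb: "cball w0 s0 \<subseteq> ball 0 (real n)" using cball_subset_ball_0 K(2) by metis
      have "U \<subseteq> cball z (r + ?e)"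
      proof
        fix x assume x: "x \<in> U"
        have "dist z x \<le> r + ?e + e" if e: "e > 0" for e
        proof -
          obtain w s where ws: "cball w s \<in> A" "cball w s \<subseteq> cball w0 s0" "s \<ge> 0" "s < r + e / 2" "dist z w \<le> s - r"
            using approx[of "e / 2" "cball w0 s0"] e K(1) by auto
          have "x \<in> thicken n (cball w s)" using U[OF ws(1)] x by blast
          also have "\<dots> = cball w (s + ?e)" using ws(2) Kb by (intro thicken_cball ws(3)) auto
          finally have "dist w x \<le> s + ?e" by simp
          then show ?thesis using dist_triangle[of z x w] ws by linarith
        qed
        then have "dist z x \<le> r + ?e" by (rule field_le_epsilon)
        then show "x \<in> cball z (r + ?e)" by simp
      qed
      also have "\<dots> = thicken n X" using thicken_cball[OF r(1)] True r X_eq by metis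
      finally show ?thesis .
    qed (simp add: thicken_def)
    then show "thicken n X \<sqsubseteq>\<^bsub>Disk\<^esub> U" by simp
  qed
qed (auto simp: thicken_mono)

text \<open>A finite net of centre-radius pairs of mesh a quarter of the enlargement \<open>?e\<close>, with
  \<open>?e / 2\<close> added to each radius, interpolates between a disk and its enlargement.\<close>

lemma thicken_separated:
  "\<exists>M. finite M \<and> M \<subseteq> carrier Disk \<and>
    (\<forall>X\<in>carrier Disk. \<exists>m\<in>M. thicken n X \<sqsubseteq>\<^bsub>Disk\<^esub> m \<and> m \<sqsubseteq>\<^bsub>Disk\<^esub> X)"
proof -
  let ?e = "1 / (real n + 1)"
  let ?K = "cball (0 :: real ^ 2) (real n) \<times> {0..real n}"
  have "compact ?K" by (intro compact_Times) auto
  then obtain P where P: "P \<subseteq> ?K" "finite P" "?K \<subseteq> (\<Union>p\<in>P. ball p (?e / 4))"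
  proof (rule compactE_image)
    show "open (ball p (?e / 4))" for p :: "(real ^ 2) \<times> real" by simp
    have "p \<in> ball p (?e / 4)" for p :: "(real ^ 2) \<times> real" by (simp only: centre_in_ball) simp
    then show "?K \<subseteq> (\<Union>p\<in>?K. ball p (?e / 4))" by blast
  qed
  let ?M = "insert UNIV ((\<lambda>(w, s). cball w (s + ?e / 2)) ` P)"
  show ?thesis
  proof (intro exI conjI ballI)
    show "finite ?M" using P(2) by simp
    show "?M \<subseteq> carrier Disk"
    proof
      fix X assume "X \<in> ?M"
      then consider "X = UNIV" | w s where "(w, s) \<in> P" "X = cball w (s + ?e / 2)" by auto
      then show "X \<in> carrier Disk"
      proof cases
        case 2
        then have "s + ?e / 2 \<ge> 0" using P(1) by auto
        then show ?thesis using 2(2) by (metis Disk_simps(1))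
      qed simp
    qed
    fix X assume X: "X \<in> carrier Disk"
    show "\<exists>m\<in>?M. thicken n X \<sqsubseteq>\<^bsub>Disk\<^esub> m \<and> m \<sqsubseteq>\<^bsub>Disk\<^esub> X"
    proof (cases "X \<subseteq> ball 0 (real n)")
      case True
      then obtain z r where zr: "r \<ge> 0" "X = cball z r"
        using X by (metis Disk_simps(1) UNIV_not_subset_cball ball_subset_cball order_trans)
      have "norm z + r < real n" using True zr cball_subset_ball_0 by metis
      then have "norm z \<le> real n" "r \<le> real n" using zr(1) norm_ge_zero[of z] by linarith+
      then have "(z, r) \<in> ?K" using zr(1) by simp
      then have "(z, r) \<in> (\<Union>p\<in>P. ball p (?e / 4))" using P(3) by (rule rev_subsetD)
      then obtain p where p: "p \<in> P" "dist p (z, r) < ?e / 4" unfolding UN_iff mem_ball by blast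
      obtain w s where ws: "p = (w, s)" by (cases p)
      have d: "dist w z < ?e / 4" "dist s r < ?e / 4"
        using p(2) dist_fst_le[of p "(z, r)"] dist_snd_le[of p "(z, r)"] ws by auto
      have "a + r \<le> s + t / 2 \<and> a + (s + t / 2) \<le> r + t" if "a < t / 4" "\<bar>s - r\<bar> < t / 4" for a t :: real
        using that by linarith
      from this[OF d[unfolded dist_real_def]]
      have radii: "dist w z + r \<le> s + ?e / 2" "dist w z + (s + ?e / 2) \<le> r + ?e" by blast+
      have "cball w (s + ?e / 2) \<in> ?M" using p(1) ws by auto
      moreover have "X \<subseteq> cball w (s + ?e / 2)"
        unfolding zr(2) cball_subset_cball_iff dist_commute[of z w] using radii(1) by blast
      moreover have "cball w (s + ?e / 2) \<subseteq> thicken n X"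
        unfolding thicken_cball[OF zr(1) True[unfolded zr(2)], folded zr(2)] cball_subset_cball_iff
        using radii(2) by blast
      ultimately show ?thesis by auto
    qed (simp add: thicken_def)
  qed
qed

lemma thicken_sup:
  assumes X: "X \<in> carrier Disk"
  shows "is_sup Disk X (range (\<lambda>n. thicken n X))"
proof (rule is_supI[OF _ X])
  show "range (\<lambda>n. thicken n X) \<subseteq> carrier Disk" using thicken_carrier[OF X] by blast
  show "Y \<sqsubseteq>\<^bsub>Disk\<^esub> X" if "Y \<in> range (\<lambda>n. thicken n X)" for Y
    using that subset_thicken by auto
  fix U assume "\<And>Y. Y \<in> range (\<lambda>n. thicken n X) \<Longrightarrow> Y \<sqsubseteq>\<^bsub>Disk\<^esub> U"
  then have U: "U \<subseteq> thicken n X" for n by auto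
  have "U \<subseteq> X"
  proof (cases "X = UNIV")
    case False
    then obtain z r where zr: "r \<ge> 0" "X = cball z r" using X by auto
    show ?thesis
    proof
      fix x assume x: "x \<in> U"
      have "dist z x \<le> r + e" if e: "e > 0" for e
      proof -
        obtain n where n: "1 / e + norm z + r < real n" using reals_Archimedean2 by blast
        have "norm z + r < real n" using n e by (smt (verit) divide_pos_pos)
        then have "thicken n X = cball z (r + 1 / (real n + 1))"
          using thicken_cball zr cball_subset_ball_0 by metis
        then have "dist z x \<le> r + 1 / (real n + 1)" using U[of n] x by auto
        moreover have "1 / e < real n + 1" using n zr(1) norm_ge_zero[of z] by linarith
        then have "1 / (real n + 1) < e" using e by (simp add: field_simps)
        ultimately show ?thesis by linarith
      qed
      then show "x \<in> X" using zr(2) by (simp add: field_le_epsilon)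
    qed
  qed simp
  then show "X \<sqsubseteq>\<^bsub>Disk\<^esub> U" by simp
qed

lemma Disk_fs_poset: "fs_poset Disk (range (\<lambda>n. restrict (thicken n) (carrier Disk)))"
proof (rule fs_poset.intro)
  let ?t = "\<lambda>n. restrict (thicken n) (carrier Disk)"
  have t: "?t n X = thicken n X" if "X \<in> carrier Disk" for n X using that by simp
  have mono: "?t m \<sqsubseteq>\<^bsub>scott_space Disk Disk\<^esub> ?t n" if "m \<le> n" for m n
    unfolding scott_space_le using t thicken_antimono[OF that] by (metis Disk_simps(2))
  show "partial_order Disk" by (rule Disk_partial_order)
  show "directed (scott_space Disk Disk) (range ?t)"
    unfolding directed_def
  proof (intro conjI ballI)
    show "range ?t \<subseteq> carrier (scott_space Disk Disk)"
      using scott_space_restrict[OF thicken_scott_continuous] by blast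
    fix f g assume "f \<in> range ?t" "g \<in> range ?t"
    then obtain m n where mn: "f = ?t m" "g = ?t n" by blast
    have "f \<sqsubseteq>\<^bsub>scott_space Disk Disk\<^esub> ?t (max m n)" "g \<sqsubseteq>\<^bsub>scott_space Disk Disk\<^esub> ?t (max m n)"
      unfolding mn by (intro mono; simp)+
    then show "\<exists>h\<in>range ?t. f \<sqsubseteq>\<^bsub>scott_space Disk Disk\<^esub> h \<and> g \<sqsubseteq>\<^bsub>scott_space Disk Disk\<^esub> h" by blast
  qed simp
  show "finitely_separated Disk d" if d: "d \<in> range ?t" for d
  proof -
    obtain n where n: "d = ?t n" using d by blast
    obtain M where M: "finite M" "M \<subseteq> carrier Disk"
      "\<forall>X\<in>carrier Disk. \<exists>m\<in>M. thicken n X \<sqsubseteq>\<^bsub>Disk\<^esub> m \<and> m \<sqsubseteq>\<^bsub>Disk\<^esub> X"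
      using thicken_separated[of n] by blast
    have "d X = thicken n X" if "X \<in> carrier Disk" for X unfolding n by (rule t[OF that])
    then have "\<forall>X\<in>carrier Disk. \<exists>m\<in>M. d X \<sqsubseteq>\<^bsub>Disk\<^esub> m \<and> m \<sqsubseteq>\<^bsub>Disk\<^esub> X"
      using M(3) by (simp del: Disk_simps)
    then show ?thesis unfolding finitely_separated_def using M(1,2) by blast
  qed
  show "is_sup Disk X ((\<lambda>d. d X) ` range ?t)" if X: "X \<in> carrier Disk" for X
  proof -
    have "(\<lambda>d. d X) ` range ?t = range (\<lambda>n. thicken n X)" by (simp only: image_image t[OF X])
    then show ?thesis using thicken_sup[OF X] by simp
  qed
qed

theorem corollary7p5:
  shows "continuous_dcpo (scott_space (adjoin_top Disk) plotkin_tie) \<and>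
    \<not> FS_domain (scott_space (adjoin_top Disk) plotkin_tie)"
proof
  show "continuous_dcpo (scott_space (adjoin_top Disk) plotkin_tie)"
    by (rule fs_poset.function_space_continuous[OF fs_poset_adjoin_top[OF Disk_dcpo Disk_fs_poset]])
  have "top.Top \<in> carrier (adjoin_top Disk)" by simp
  then show "\<not> FS_domain (scott_space (adjoin_top Disk) plotkin_tie)"
    by (intro function_space_not_FS adjoin_top_partial_order Disk_partial_order) blast
qed

end
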